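(* Let $f\colon\mathbb{R}\to\mathbb{R}$ be $1$-periodic and Lipschitz continuous, and let $U$ be a random variable uniformly distributed on $[0,1]$. Let $(a_k)_{k\in\mathbb{N}}$ be a geometric sequence, i.e. $a_k=q^k$ for some $q\in\mathbb{N}$ with $q\ge 2$, and put $S_n:=\sum_{k=1}^n f(a_kU)=\sum_{k=1}^n f(q^kU)$, $n\in\mathbb{N}$. Then $$\Lambda_q^f(\theta):=\lim_{n\to\infty}\frac1n\log\mathbb{E}\bigl[\mathrm{e}^{\theta S_n}\bigr]$$ exists, with the convergence holding uniformly on compact subsets of an open set $\mathcal{D}$ in the complex plane such that $\mathbb{R}\subset\mathcal{D}$. Moreover, $(S_n/n)_{n\in\mathbb{N}}$ satisfies a large deviation principle in $\mathbb{R}$ at speed $n$ with good rate function $I_q^f\colon\mathbb{R}\to[0,\infty]$ given by the Legendre--Fenchel transform of $\Lambda_q^f$, i.e. $$I_q^f(x):=\sup_{\theta\in\mathbb{R}}\bigl[\theta x-\Lambda_q^f(\theta)\bigr].$$ Furthermore, the limit $\lim_{q\to\infty}I_q^f(x)=\widetilde{I}^f(x)$ holds uniformly on compact subsets of the interval $(-1,1)$, where $$\widetilde{I}^f(x):=\sup_{\theta\in\mathbb{R}}\bigl[\theta x-\widetilde{\Lambda}^f(\theta)\bigr],\qquad\widetilde{\Lambda}^f(\theta):=\log\int_0^1\mathrm{e}^{\theta f(\omega)}\,\mathrm{d}\omega .$$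
   Context: A sequence $(X_n)_{n\in\mathbb{N}}$ of real random variables satisfies a large deviation principle (LDP) in $\mathbb{R}$ at speed $(s_n)_{n\in\mathbb{N}}$ (positive reals tending to infinity) with rate function $\mathbb{I}\colon\mathbb{R}\to[0,\infty]$ if $\mathbb{I}$ is lower semicontinuous and for every Borel set $A\subset\mathbb{R}$ $$-\inf_{x\in A^\circ}\mathbb{I}(x)\le\liminf_{n\to\infty}\frac1{s_n}\log\mathbb{P}[X_n\in A]\le\limsup_{n\to\infty}\frac1{s_n}\log\mathbb{P}[X_n\in A]\le-\inf_{x\in\overline{A}}\mathbb{I}(x),$$ where $A^\circ$ and $\overline{A}$ are the interior and closure of $A$. "Speed $n$" means $s_n=n$. The rate function is called good if it has compact level sets $\{x : \mathbb{I}(x)\le c\}$, $c\in[0,\infty)$.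
   Formalization: The last limit is proved uniformly on compact subsets of (-1,1) avoiding min f and max f; as stated it is false: for f(x)=sin(2πx)/2 and q not 1 mod 4, I_q is infinite just left of 1/2 where Ĩ is finite. Nothing is excluded if (-1,1) lies in the range of f. *)

theory Defs
  imports "HOL-Probability.Probability"
begin

text \<open>Logarithm of a probability, with \<open>log 0 = -\<infinity>\<close> (the library has \<^term>\<open>ln (0::real) = 0\<close>).\<close>

definition elog :: "real \<Rightarrow> ereal" where
  "elog p = (if p = 0 then -\<infinity> else ereal (ln p))"

definition lower_semicontinuous :: "(real \<Rightarrow> ereal) \<Rightarrow> bool" where
  "lower_semicontinuous I \<longleftrightarrow> (\<forall>x. I x \<le> Liminf (at x) I)"

text \<open>Sequences are indexed by the positive integers; the value at index \<open>0\<close> is never used.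
  Rate functions with values in \<open>[0,\<infinity>]\<close> are represented as nonnegative \<^typ>\<open>ereal\<close>-valued
  functions, and an infimum over the empty set is \<open>\<infinity>\<close>.\<close>

definition satisfies_LDP ::
  "'a measure \<Rightarrow> (nat \<Rightarrow> 'a \<Rightarrow> real) \<Rightarrow> (nat \<Rightarrow> real) \<Rightarrow> (real \<Rightarrow> ereal) \<Rightarrow> bool" where
  "satisfies_LDP M X s I \<longleftrightarrow>
     (\<forall>n\<ge>1. X n \<in> borel_measurable M) \<and>
     (\<forall>n\<ge>1. 0 < s n) \<and> filterlim s at_top sequentially \<and>
     (\<forall>x. 0 \<le> I x) \<and> lower_semicontinuous I \<and>
     (\<forall>A\<in>sets borel.
        - (INF x\<in>interior A. I x)
          \<le> liminf (\<lambda>n. elog (measure M {\<omega> \<in> space M. X n \<omega> \<in> A}) / ereal (s n)) \<and>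
        liminf (\<lambda>n. elog (measure M {\<omega> \<in> space M. X n \<omega> \<in> A}) / ereal (s n))
          \<le> limsup (\<lambda>n. elog (measure M {\<omega> \<in> space M. X n \<omega> \<in> A}) / ereal (s n)) \<and>
        limsup (\<lambda>n. elog (measure M {\<omega> \<in> space M. X n \<omega> \<in> A}) / ereal (s n))
          \<le> - (INF x\<in>closure A. I x))"

definition good_rate_function :: "(real \<Rightarrow> ereal) \<Rightarrow> bool" where
  "good_rate_function I \<longleftrightarrow> (\<forall>c::real. 0 \<le> c \<longrightarrow> compact {x. I x \<le> ereal c})"

definition legendre_fenchel :: "(real \<Rightarrow> real) \<Rightarrow> real \<Rightarrow> ereal" where
  "legendre_fenchel \<Lambda> x = (SUP \<theta>. ereal (\<theta> * x - \<Lambda> \<theta>))"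

definition lacunary_sum ::
  "(nat \<Rightarrow> nat) \<Rightarrow> (real \<Rightarrow> real) \<Rightarrow> ('a \<Rightarrow> real) \<Rightarrow> nat \<Rightarrow> 'a \<Rightarrow> real" where
  "lacunary_sum a f U n \<omega> = (\<Sum>k=1..n. f (real (a k) * U \<omega>))"

abbreviation geometric_sum ::
  "nat \<Rightarrow> (real \<Rightarrow> real) \<Rightarrow> ('a \<Rightarrow> real) \<Rightarrow> nat \<Rightarrow> 'a \<Rightarrow> real" where
  "geometric_sum q \<equiv> lacunary_sum (\<lambda>k. q ^ k)"

definition scaled_log_mgf ::
  "'a measure \<Rightarrow> ('a \<Rightarrow> real) \<Rightarrow> (real \<Rightarrow> real) \<Rightarrow> nat \<Rightarrow> nat \<Rightarrow> real \<Rightarrow> real" where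
  "scaled_log_mgf M U f q n \<theta> =
     ln (\<integral>\<omega>. exp (\<theta> * geometric_sum q f U n \<omega>) \<partial>M) / real n"

text \<open>Only meaningful together with the convergence of the sequence on the right.\<close>

definition Lambda_geom ::
  "'a measure \<Rightarrow> ('a \<Rightarrow> real) \<Rightarrow> (real \<Rightarrow> real) \<Rightarrow> nat \<Rightarrow> real \<Rightarrow> real" where
  "Lambda_geom M U f q \<theta> = lim (\<lambda>n. scaled_log_mgf M U f q n \<theta>)"

definition I_geom ::
  "'a measure \<Rightarrow> ('a \<Rightarrow> real) \<Rightarrow> (real \<Rightarrow> real) \<Rightarrow> nat \<Rightarrow> real \<Rightarrow> ereal" where
  "I_geom M U f q = legendre_fenchel (Lambda_geom M U f q)"

definition Lambda_indep :: "(real \<Rightarrow> real) \<Rightarrow> real \<Rightarrow> real" where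
  "Lambda_indep f \<theta> = ln (LBINT \<omega>:{0..1}. exp (\<theta> * f \<omega>))"

definition I_indep :: "(real \<Rightarrow> real) \<Rightarrow> real \<Rightarrow> ereal" where
  "I_indep f = legendre_fenchel (Lambda_indep f)"

text \<open>The complex logarithm of \<open>E[exp (z S\<^sub>n)]\<close> is read as the holomorphic branch on a
  neighbourhood of the real axis that is real on the real axis; the principal branch \<^term>\<open>Ln\<close>
  would be wrong, since division by \<open>n\<close> would kill the imaginary part.  The first two
  conditions on \<open>L n\<close> say that it is this branch, so in particular the expectations do not
  vanish on \<open>D\<close>.\<close>

definition complex_log_mgf_converges ::
  "'a measure \<Rightarrow> (nat \<Rightarrow> 'a \<Rightarrow> real) \<Rightarrow> (real \<Rightarrow> real) \<Rightarrow> complex set \<Rightarrow> bool" where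
  "complex_log_mgf_converges M S \<Lambda> D \<longleftrightarrow>
     (\<exists>(L :: nat \<Rightarrow> complex \<Rightarrow> complex) (\<Lambda>c :: complex \<Rightarrow> complex).
        (\<forall>n\<ge>1. L n holomorphic_on D \<and>
           (\<forall>z\<in>D. exp (L n z) = (\<integral>\<omega>. exp (z * complex_of_real (S n \<omega>)) \<partial>M)) \<and>
           (\<forall>\<theta>::real. L n (complex_of_real \<theta>)
              = complex_of_real (ln (\<integral>\<omega>. exp (\<theta> * S n \<omega>) \<partial>M)))) \<and>
        (\<forall>\<theta>::real. \<Lambda>c (complex_of_real \<theta>) = complex_of_real (\<Lambda> \<theta>)) \<and>
        (\<forall>K. compact K \<and> K \<subseteq> D \<longrightarrow>
           uniform_limit K (\<lambda>n z. L n z / of_nat n) \<Lambda>c sequentially))"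

text \<open>Uniform convergence of extended-real functions.  Where the functions are finite, this is
  \<open>\<bar>F n x - g x\<bar> \<le> \<epsilon>\<close>; where \<open>g x = \<infinity>\<close> it requires \<open>F n x = \<infinity>\<close>.

  For \<open>F = I_geom M U f\<close> and \<open>g = I_indep f\<close> this can fail on compact sets that contain an
  endpoint of the interval \<^term>\<open>range f\<close>: for \<open>f x = sin (2 * pi * x) / 2\<close> and
  \<open>q mod 4 \<noteq> 1\<close>, \<open>I_geom M U f q\<close> is \<open>\<infinity>\<close> on a left neighbourhood of \<open>1/2\<close>,
  whereas \<open>I_indep f\<close> is finite on \<open>(-1/2, 1/2)\<close>.  This is why compact sets that meet
  \<open>frontier (range f)\<close> have to be excluded.  If \<open>(-1,1) \<subseteq> range f\<close>, as for
  \<open>f x = cos (2 * pi * x)\<close>, then no subset of \<open>(-1,1)\<close> is excluded.\<close>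

definition ereal_uniform_limit ::
  "real set \<Rightarrow> (nat \<Rightarrow> real \<Rightarrow> ereal) \<Rightarrow> (real \<Rightarrow> ereal) \<Rightarrow> bool" where
  "ereal_uniform_limit K F g \<longleftrightarrow>
     (\<forall>\<epsilon>>0. \<forall>\<^sub>F n in sequentially. \<forall>x\<in>K.
        F n x \<le> g x + ereal \<epsilon> \<and> g x \<le> F n x + ereal \<epsilon>)"

end

theory Submission
  imports Defs "HOL-Complex_Analysis.Complex_Analysis"
begin

text \<open>
  The map \<open>x \<mapsto> q x\<close> modulo \<open>1\<close> preserves the uniform distribution and has \<open>q\<close> inverse branches, each of
  which contracts distances by \<open>q\<close>.  Hence \<open>Z\<^sub>n(z) = E[exp (z S\<^sub>n)]\<close> is the integral of the \<open>n\<close>-th iterate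
  \<open>h\<^sub>n\<close>, started at the constant \<open>1\<close>, of the transfer operator
  \<open>h \<mapsto> (\<lambda>x. 1/q * (\<Sum>j<q. exp (z f ((x + j)/q)) h ((x + j)/q)))\<close> (\<open>integral_prod_geometric\<close>).

  For real \<open>z = \<theta>\<close> the functions \<open>h\<^sub>n\<close> are positive, and \<open>ln h\<^sub>n\<close> has Lipschitz constant at most
  \<open>2 \<bar>\<theta>\<bar> C / q\<close>.  Therefore \<open>ln Z\<^sub>n(\<theta>)\<close> is additive in \<open>n\<close> up to the error \<open>2 \<bar>\<theta>\<bar> C / q\<close>
  (\<open>quasi_additive_ln_density\<close>).  This yields both the existence of \<open>\<Lambda>\<^sub>q(\<theta>)\<close> and the estimate
  \<open>\<bar>\<Lambda>\<^sub>q(\<theta>) - ln Z\<^sub>1(\<theta>)\<bar> \<le> 2 \<bar>\<theta>\<bar> C / q\<close>, where \<open>ln Z\<^sub>1\<close> is the function \<open>Lambda_indep f\<close>.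

  For complex \<open>z\<close> near \<open>\<theta>\<close> the quotient \<open>g\<^sub>n\<close> of the complex and the real densities evolves by an
  averaging operator with positive weights, composed with multiplication by \<open>exp ((z - \<theta>) f)\<close>.  Averaging
  strictly contracts oscillations (\<open>markov_contraction\<close>), and so \<open>g\<^sub>n\<close> stays nearly constant for all \<open>n\<close>
  if \<open>z - \<theta>\<close> is small (\<open>perturbed_density_cone\<close>).  Consequently \<open>Z\<^sub>n(z)\<close> does not vanish, and the quotients
  \<open>Z\<^sub>n\<^sub>+\<^sub>1(z) / Z\<^sub>n(z)\<close> remain in the right half plane and bounded.  The sum of their logarithms is the desired
  branch of the logarithm of \<open>Z\<^sub>n\<close>; divided by \<open>n\<close> it is locally bounded and converges on the real axis,
  hence locally uniformly by Vitali's theorem (\<open>complex_log_mgf\<close>).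

  In particular \<open>\<Lambda>\<^sub>q\<close> is differentiable, and the large deviation principle is the Gaertner--Ellis theorem
  (\<open>gaertner_ellis\<close>).  Finally, the estimate above shows that \<open>\<Lambda>\<^sub>q\<close> tends to \<open>Lambda_indep f\<close> with an error
  linear in \<open>\<bar>\<theta>\<bar>\<close>.  At points at distance \<open>\<delta>\<close> from the frontier of the range of \<open>f\<close> the function
  \<open>\<theta> x - Lambda_indep f \<theta>\<close> tends linearly to \<open>-\<infinity>\<close> in both directions, or to \<open>\<infinity>\<close> in one, which
  outweighs this error for large \<open>q\<close>: in the first case the suprema converge uniformly, in the second
  both are infinite (\<open>rate_functions_uniform_limit\<close>).\<close>

section \<open>Quasi-additive sequences\<close>

lemma quasi_additive_multiple:
  fixes a :: "nat \<Rightarrow> real"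
  assumes "\<And>m n. \<bar>a (m + n) - a m - a n\<bar> \<le> c"
  shows "\<bar>a (Suc k * m) - real (Suc k) * a m\<bar> \<le> real k * c"
proof (induction k)
  case (Suc k)
  have "\<bar>a (m + Suc k * m) - a m - a (Suc k * m)\<bar> \<le> c"
    by (rule assms)
  with Suc show ?case
    by (simp add: algebra_simps)
qed simp

text \<open>Both \<open>a (k * m) \<approx> k * a m\<close> and \<open>a (k * m) \<approx> m * a k\<close> hold up to a bounded multiple of
  \<open>k\<close> and \<open>m\<close>, respectively, so that \<open>a n / n\<close> is a Cauchy sequence.  The explicit distance to the limit matters as
  much as convergence: at \<open>m = 1\<close> it compares \<open>\<Lambda>\<^sub>q\<close> with the independent case.\<close>

lemma quasi_additive_convergent:
  fixes a :: "nat \<Rightarrow> real"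
  assumes qa: "\<And>m n. \<bar>a (m + n) - a m - a n\<bar> \<le> c"
  obtains l where "(\<lambda>n. a n / real n) \<longlonglongrightarrow> l"
    and "\<And>m. 1 \<le> m \<Longrightarrow> \<bar>l - a m / real m\<bar> \<le> c / real m"
proof -
  have c0: "0 \<le> c"
    using qa[of 0 0] by linarith
  have mult: "\<bar>a (k * m) / real (k * m) - a m / real m\<bar> \<le> c / real m"
    if km: "1 \<le> k" "1 \<le> m" for k m
  proof -
    obtain j where j: "k = Suc j"
      using km by (cases k) auto
    have "\<bar>a (k * m) - real k * a m\<bar> \<le> real j * c"
      using quasi_additive_multiple[of a c, OF qa] j by blast
    also have "\<dots> \<le> real k * c"
      using j c0 by (simp add: mult_right_mono)
    finally have "\<bar>a (k * m) - real k * a m\<bar> / (real k * real m) \<le> real k * c / (real k * real m)"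
      by (intro divide_right_mono) auto
    moreover have "\<bar>a (k * m) / real (k * m) - a m / real m\<bar>
        = \<bar>(a (k * m) - real k * a m) / (real k * real m)\<bar>"
      using km by (intro arg_cong[where f = abs]) (simp add: field_simps)
    ultimately show ?thesis
      using km by (simp add: abs_mult)
  qed
  have cauchy: "\<bar>a m / real m - a n / real n\<bar> \<le> c / real m + c / real n"
    if "1 \<le> m" "1 \<le> n" for m n
    using mult[OF that] mult[OF that(2,1)] by (simp add: mult.commute)
  have "Cauchy (\<lambda>n. a n / real n)"
  proof (rule metric_CauchyI)
    fix e :: real
    assume e: "0 < e"
    obtain N where N: "2 * c / e < real N"
      using reals_Archimedean2 by blast
    have small: "c / real n < e / 2" if "n \<ge> Suc N" for n
    proof -
      have "2 * c / e < real n"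
        using N that by linarith
      thus ?thesis
        using e that by (simp add: field_simps)
    qed
    show "\<exists>M. \<forall>m\<ge>M. \<forall>n\<ge>M. dist (a m / real m) (a n / real n) < e"
    proof (intro exI[of _ "Suc N"] allI impI)
      fix m n
      assume mn: "m \<ge> Suc N" "n \<ge> Suc N"
      show "dist (a m / real m) (a n / real n) < e"
        using cauchy[of m n] small[OF mn(1)] small[OF mn(2)] mn unfolding dist_real_def by linarith
    qed
  qed
  then obtain l where l: "(\<lambda>n. a n / real n) \<longlonglongrightarrow> l"
    using Cauchy_convergent_iff convergent_def by blast
  have "\<bar>l - a m / real m\<bar> \<le> c / real m" if m: "1 \<le> m" for m
  proof (rule LIMSEQ_le_const2)
    have "(\<lambda>k. a (k * m) / real (k * m)) \<longlonglongrightarrow> l"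
      using LIMSEQ_subseq_LIMSEQ[OF l, of "\<lambda>k. k * m"] m
      by (simp add: strict_mono_def o_def)
    thus "(\<lambda>k. \<bar>a (k * m) / real (k * m) - a m / real m\<bar>) \<longlonglongrightarrow> \<bar>l - a m / real m\<bar>"
      by (intro tendsto_intros)
    show "\<exists>N. \<forall>k\<ge>N. \<bar>a (k * m) / real (k * m) - a m / real m\<bar> \<le> c / real m"
      using mult m by blast
  qed
  with l show ?thesis
    using that by blast
qed

section \<open>Averaging over inverse branches\<close>

text \<open>Averaging over the \<open>q\<close> inverse branches of \<open>x \<mapsto> q x\<close> modulo \<open>1\<close>: the transfer operator of this map
  with respect to Lebesgue measure.\<close>

definition branch_mean :: "nat \<Rightarrow> (real \<Rightarrow> 'a::real_normed_field) \<Rightarrow> real \<Rightarrow> 'a" where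
  "branch_mean q h x = (\<Sum>j<q. h ((x + real j) / real q)) / of_nat q"

lemma integral_unit_pieces:
  fixes g :: "real \<Rightarrow> 'a::euclidean_space"
  assumes "continuous_on UNIV g"
  shows "integral {0..real n} g = (\<Sum>j<n. integral {0..1} (\<lambda>x. g (x + real j)))"
proof (induction n)
  case (Suc n)
  have int: "g integrable_on {a..b}" for a b
    by (intro integrable_continuous_interval continuous_on_subset[OF assms]) auto
  have "(g has_integral integral {real n..real n + 1} g) (cbox (real n) (real n + 1))"
    using int[of "real n" "real n + 1"] by (simp add: has_integral_integral)
  from has_integral_affinity'[OF this, of 1 "real n"]
  have "((\<lambda>x. g (x + real n)) has_integral integral {real n..real n + 1} g) {0..1}"
    by simp
  hence "integral {real n..real n + 1} g = integral {0..1} (\<lambda>x. g (x + real n))"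
    by (simp add: integral_unique)
  moreover have "integral {0..real n} g + integral {real n..real n + 1} g = integral {0..real n + 1} g"
    by (rule Henstock_Kurzweil_Integration.integral_combine[OF _ _ int]) auto
  ultimately show ?case
    using Suc by (simp add: add.commute)
qed simp

lemma continuous_on_branch_mean [continuous_intros]:
  fixes h :: "real \<Rightarrow> 'a::real_normed_field"
  assumes "continuous_on UNIV h"
  shows "continuous_on A (branch_mean q h)"
  unfolding branch_mean_def divide_inverse
  by (intro continuous_intros continuous_on_compose2[OF assms]) auto

text \<open>Substitute \<open>x = (y + j) / q\<close> on each interval \<open>[j / q, (j + 1) / q]\<close>.\<close>

lemma integral_branch_mean:
  fixes h :: "real \<Rightarrow> 'a::{real_normed_field,euclidean_space}"
  assumes h: "continuous_on UNIV h" and q: "0 < q"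
  shows "integral {0..1} (branch_mean q h) = integral {0..1} h"
proof -
  let ?g = "\<lambda>y. h (y / real q)"
  have g: "continuous_on UNIV ?g"
    by (intro continuous_on_compose2[OF h]) (auto simp: divide_inverse intro!: continuous_intros)
  have "(h has_integral integral {0..1} h) (cbox 0 1)"
    using h by (auto intro!: integrable_integral integrable_continuous_interval
        intro: continuous_on_subset)
  from has_integral_affinity'[OF this, of "1 / real q" 0]
  have "(?g has_integral (real q *\<^sub>R integral {0..1} h)) {0..real q}"
    using q by (simp add: field_simps)
  hence "real q *\<^sub>R integral {0..1} h = integral {0..real q} ?g"
    by (simp add: integral_unique)
  also have "\<dots> = (\<Sum>j<q. integral {0..1} (\<lambda>x. ?g (x + real j)))"
    by (rule integral_unit_pieces[OF g])
  also have "\<dots> = integral {0..1} (\<lambda>x. \<Sum>j<q. ?g (x + real j))"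
    by (subst integral_sum)
       (auto intro!: integrable_continuous_interval continuous_intros continuous_on_compose2[OF g])
  finally have "integral {0..1} (\<lambda>x. \<Sum>j<q. ?g (x + real j)) = real q *\<^sub>R integral {0..1} h"
    by simp
  thus ?thesis
    unfolding branch_mean_def using q by (simp add: scaleR_conv_of_real)
qed

text \<open>The \<open>n\<close>-th iterate of the weighted transfer operator \<open>h \<mapsto> branch_mean q (w * h)\<close>, applied to the
  constant function \<open>1\<close>.\<close>

primrec branch_density :: "nat \<Rightarrow> (real \<Rightarrow> 'a::real_normed_field) \<Rightarrow> nat \<Rightarrow> real \<Rightarrow> 'a" where
  "branch_density q w 0 = (\<lambda>x. 1)"
| "branch_density q w (Suc n) = branch_mean q (\<lambda>x. w x * branch_density q w n x)"

lemma continuous_on_branch_density [continuous_intros]: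
  fixes w :: "real \<Rightarrow> 'a::real_normed_field"
  assumes "continuous_on UNIV w"
  shows "continuous_on A (branch_density q w n)"
proof -
  have "continuous_on UNIV (branch_density q w n)"
    by (induction n) (auto intro!: continuous_intros assms)
  thus ?thesis
    by (rule continuous_on_subset) auto
qed

lemma periodic_add_nat:
  fixes w :: "real \<Rightarrow> 'a"
  assumes "\<And>x. w (x + 1) = w x"
  shows "w (x + real n) = w x"
proof (induction n)
  case (Suc n)
  have "w (x + real (Suc n)) = w ((x + real n) + 1)"
    by (simp add: ac_simps)
  with Suc show ?case
    by (simp only: assms)
qed simp

text \<open>The factors \<open>w (q^k x)\<close> with \<open>k \<ge> 1\<close> are periodic functions of \<open>q x\<close>, so \<^const>\<open>branch_mean\<close> pulls
  them out unchanged; one application of the transfer operator therefore absorbs the factor \<open>w x\<close> into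
  the density and shifts the product by one.  With \<open>m > 0\<close> this separates the first \<open>m\<close> factors of a
  product of \<open>n + m\<close> ones, in the form of a density, from the other \<open>n\<close>.\<close>

lemma integral_prod_branch_density:
  fixes w :: "real \<Rightarrow> 'a::{real_normed_field,euclidean_space}"
  assumes w: "continuous_on UNIV w" and per: "\<And>x. w (x + 1) = w x" and q: "0 < q"
  shows "integral {0..1} (\<lambda>x. (\<Prod>k<n. w (real (q ^ k) * x)) * branch_density q w m x)
    = integral {0..1} (branch_density q w (n + m))"
proof (induction n arbitrary: m)
  case (Suc n)
  define G where "G x = (\<Prod>k<n. w (real (q ^ k) * x))" for x
  have G: "continuous_on UNIV G"
    unfolding G_def by (intro continuous_intros continuous_on_compose2[OF w]) auto
  have Gper: "G (x + real j) = G x" for x j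
    unfolding G_def
  proof (intro prod.cong refl)
    fix k
    have "w (real (q ^ k) * x + real (q ^ k * j)) = w (real (q ^ k) * x)"
      by (rule periodic_add_nat[of w, OF per])
    thus "w (real (q ^ k) * (x + real j)) = w (real (q ^ k) * x)"
      by (simp add: algebra_simps)
  qed
  have split: "(\<Prod>k<Suc n. w (real (q ^ k) * x)) = w x * G (real q * x)" for x
    unfolding G_def by (simp add: prod.lessThan_Suc_shift ac_simps del: prod.lessThan_Suc)
  let ?h = "\<lambda>x. G (real q * x) * (w x * branch_density q w m x)"
  have h: "continuous_on UNIV ?h"
    by (intro continuous_intros w continuous_on_compose2[OF G]) auto
  have "integral {0..1} (\<lambda>x. (\<Prod>k<Suc n. w (real (q ^ k) * x)) * branch_density q w m x)
      = integral {0..1} ?h"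
    unfolding split by (simp add: ac_simps)
  also have "\<dots> = integral {0..1} (branch_mean q ?h)"
    by (rule integral_branch_mean[OF h q, symmetric])
  also have "branch_mean q ?h = (\<lambda>y. G y * branch_density q w (Suc m) y)"
    using q Gper by (simp add: branch_mean_def sum_distrib_left fun_eq_iff)
  also have "integral {0..1} \<dots> = integral {0..1} (branch_density q w (n + Suc m))"
    unfolding G_def by (rule Suc.IH)
  finally show ?case
    by simp
qed simp

lemma integral_prod_geometric:
  fixes w :: "real \<Rightarrow> 'a::{real_normed_field,euclidean_space}"
  assumes w: "continuous_on UNIV w" and per: "\<And>x. w (x + 1) = w x" and q: "0 < q"
  shows "integral {0..1} (\<lambda>x. \<Prod>k=1..n. w (real (q ^ k) * x)) = integral {0..1} (branch_density q w n)"
proof -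
  let ?G = "\<lambda>x. \<Prod>k=1..n. w (real (q ^ k) * x)"
  have G: "continuous_on UNIV ?G"
    by (intro continuous_intros continuous_on_compose2[OF w]) auto
  have "branch_mean q ?G x = (\<Prod>k<n. w (real (q ^ k) * x))" for x
  proof -
    have "?G ((x + real j) / real q) = (\<Prod>k<n. w (real (q ^ k) * x))" for j
    proof -
      have "?G ((x + real j) / real q) = (\<Prod>k<n. w (real (q ^ Suc k) * ((x + real j) / real q)))"
        by (rule prod.reindex_bij_witness[of _ Suc "\<lambda>k. k - 1"]) auto
      also have "\<dots> = (\<Prod>k<n. w (real (q ^ k) * x + real (q ^ k * j)))"
        using q by (intro prod.cong refl arg_cong[where f = w]) (simp add: field_simps)
      also have "\<dots> = (\<Prod>k<n. w (real (q ^ k) * x))"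
        by (intro prod.cong refl periodic_add_nat per)
      finally show ?thesis .
    qed
    thus ?thesis
      unfolding branch_mean_def using q by simp
  qed
  hence "branch_mean q ?G = (\<lambda>x. \<Prod>k<n. w (real (q ^ k) * x))"
    by (rule ext)
  hence "integral {0..1} (branch_mean q ?G)
      = integral {0..1} (\<lambda>x. (\<Prod>k<n. w (real (q ^ k) * x)) * branch_density q w 0 x)"
    by simp
  also have "\<dots> = integral {0..1} (branch_density q w n)"
    using integral_prod_branch_density[OF w per q, of n 0] by simp
  finally show ?thesis
    using integral_branch_mean[OF G q] by simp
qed

section \<open>Logarithmically Lipschitz densities\<close>

text \<open>Positive functions on \<open>[0, 1]\<close> whose logarithm has Lipschitz constant \<open>A\<close>.  Written without the
  logarithm, the condition is visibly stable under sums, which is what averaging over branches requires.\<close>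

definition log_lipschitz :: "real \<Rightarrow> (real \<Rightarrow> real) \<Rightarrow> bool" where
  "log_lipschitz A h \<longleftrightarrow>
    (\<forall>x\<in>{0..1}. \<forall>y\<in>{0..1}. 0 < h x \<and> h x \<le> exp (A * \<bar>x - y\<bar>) * h y)"

lemma log_lipschitzD:
  assumes "log_lipschitz A h" "x \<in> {0..1}" "y \<in> {0..1}"
  shows "0 < h x" "h x \<le> exp (A * \<bar>x - y\<bar>) * h y"
  using assms unfolding log_lipschitz_def by auto

lemma log_lipschitz_mono:
  assumes "log_lipschitz A h" "A \<le> B"
  shows "log_lipschitz B h"
  unfolding log_lipschitz_def
proof (intro ballI conjI)
  fix x y :: real
  assume xy: "x \<in> {0..1}" "y \<in> {0..1}"
  show "0 < h x"
    using log_lipschitzD(1)[OF assms(1) xy] .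
  have "h x \<le> exp (A * \<bar>x - y\<bar>) * h y"
    using log_lipschitzD(2)[OF assms(1) xy] .
  also have "\<dots> \<le> exp (B * \<bar>x - y\<bar>) * h y"
    using assms(2) log_lipschitzD(1)[OF assms(1) xy(2,1)]
    by (intro mult_right_mono) (auto simp: mult_right_mono)
  finally show "h x \<le> exp (B * \<bar>x - y\<bar>) * h y" .
qed

lemma log_lipschitz_const: "0 < c \<Longrightarrow> log_lipschitz 0 (\<lambda>x. c)"
  by (simp add: log_lipschitz_def)

lemma log_lipschitz_mult:
  assumes "log_lipschitz A g" "log_lipschitz B h"
  shows "log_lipschitz (A + B) (\<lambda>x. g x * h x)"
  unfolding log_lipschitz_def
proof (intro ballI conjI)
  fix x y :: real
  assume xy: "x \<in> {0..1}" "y \<in> {0..1}"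
  note g = log_lipschitzD[OF assms(1) xy] and h = log_lipschitzD[OF assms(2) xy]
  show "0 < g x * h x"
    using g h by simp
  have "g x * h x \<le> (exp (A * \<bar>x - y\<bar>) * g y) * (exp (B * \<bar>x - y\<bar>) * h y)"
    using g h log_lipschitzD(1)[OF assms(1) xy(2,1)] by (intro mult_mono) auto
  thus "g x * h x \<le> exp ((A + B) * \<bar>x - y\<bar>) * (g y * h y)"
    by (simp add: exp_add algebra_simps)
qed

lemma branch_in_unit_interval:
  assumes "x \<in> {0..1}" "j < q"
  shows "(x + real j) / real q \<in> {0..1}"
proof -
  have "x + real j \<le> real q"
    using assms by auto
  thus ?thesis
    using assms by (auto simp: divide_simps)
qed

lemma branch_dist: "\<bar>(x + real j) / real q - (y + real j) / real q\<bar> = \<bar>x - y\<bar> / real q"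
  by (simp flip: diff_divide_distrib)

lemma log_lipschitz_branch:
  assumes h: "log_lipschitz A h" and xy: "x \<in> {0..1}" "y \<in> {0..1}" and j: "j < q"
  shows "h ((x + real j) / real q) \<le> exp (A / real q * \<bar>x - y\<bar>) * h ((y + real j) / real q)"
  using log_lipschitzD(2)[OF h branch_in_unit_interval[OF xy(1) j] branch_in_unit_interval[OF xy(2) j]]
  by (simp add: branch_dist)

lemma log_lipschitz_branch_mean:
  assumes h: "log_lipschitz A h" and q: "0 < q"
  shows "log_lipschitz (A / real q) (branch_mean q h)"
  unfolding log_lipschitz_def
proof (intro ballI conjI)
  fix x y :: real
  assume xy: "x \<in> {0..1}" "y \<in> {0..1}"
  show "0 < branch_mean q h x"
    unfolding branch_mean_def using q log_lipschitzD(1)[OF h branch_in_unit_interval xy(2)] xy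
    by (intro divide_pos_pos sum_pos) (auto simp: lessThan_empty_iff)
  have "(\<Sum>j<q. h ((x + real j) / real q))
      \<le> (\<Sum>j<q. exp (A / real q * \<bar>x - y\<bar>) * h ((y + real j) / real q))"
    using log_lipschitz_branch[OF h xy] by (intro sum_mono) auto
  thus "branch_mean q h x \<le> exp (A / real q * \<bar>x - y\<bar>) * branch_mean q h y"
    unfolding branch_mean_def by (simp add: sum_distrib_left divide_right_mono flip: sum_distrib_left)
qed

text \<open>One step of the transfer operator turns the constant \<open>A\<close> into \<open>(b + A) / q\<close>.  The bound
  \<open>A = 2 * b / q\<close> is preserved, since \<open>2 * b / q \<le> b\<close>, and it vanishes as \<open>q \<rightarrow> \<infinity>\<close>.\<close>

lemma log_lipschitz_branch_density:
  assumes w: "log_lipschitz b w" and b: "0 \<le> b" and q: "2 \<le> q"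
  shows "log_lipschitz (2 * b / real q) (branch_density q w n)"
proof (induction n)
  case 0
  show ?case
    using log_lipschitz_mono[OF log_lipschitz_const[of 1]] b by simp
next
  case (Suc n)
  have "2 * b / real q \<le> b"
    using b q by (simp add: field_simps mult_left_mono)
  hence "(b + 2 * b / real q) / real q \<le> 2 * b / real q"
    using q by (intro divide_right_mono) auto
  thus ?case
    using log_lipschitz_mono[OF log_lipschitz_branch_mean[OF log_lipschitz_mult[OF w Suc]]] q
    by simp
qed

lemma log_lipschitz_integral_bounds:
  assumes h: "log_lipschitz A h" and cont: "continuous_on {0..1} h" and A: "0 \<le> A"
    and x: "x \<in> {0..1}"
  shows "exp (- A) * integral {0..1} h \<le> h x" "h x \<le> exp A * integral {0..1} h"
proof -
  have int: "h integrable_on {0..1}"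
    using cont by (rule integrable_continuous_interval)
  have le: "h u \<le> exp A * h v" if "u \<in> {0..1}" "v \<in> {0..1}" for u v
  proof -
    have "A * \<bar>u - v\<bar> \<le> A * 1"
      using that A by (intro mult_left_mono) auto
    thus ?thesis
      using log_lipschitzD(2)[OF h that] log_lipschitzD(1)[OF h that(2,1)]
      by (smt (verit) exp_le_cancel_iff mult_right_mono)
  qed
  have "integral {0..1} h \<le> integral {0..1} (\<lambda>u::real. exp A * h x)"
    using le x by (intro integral_le int) auto
  thus "exp (- A) * integral {0..1} h \<le> h x"
    by (simp add: exp_minus field_simps)
  have "integral {0..1} (\<lambda>u::real. h x) \<le> integral {0..1} (\<lambda>u. exp A * h u)"
    using le x int by (intro integral_le) (auto intro!: integrable_on_cmult_left)
  thus "h x \<le> exp A * integral {0..1} h"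
    by simp
qed

lemma integral_branch_density_pos:
  assumes w: "log_lipschitz b w" and b: "0 \<le> b" and cont: "continuous_on UNIV w" and q: "2 \<le> q"
  shows "0 < integral {0..1} (branch_density q w n)"
proof -
  have "continuous_on {0..1} (branch_density q w n)"
    by (intro continuous_intros cont)
  moreover note ld = log_lipschitz_branch_density[OF w b q, of n]
  ultimately have "branch_density q w n 0 \<le> exp (2 * b / q) * integral {0..1} (branch_density q w n)"
    using b by (intro log_lipschitz_integral_bounds(2)) auto
  moreover have "0 < branch_density q w n 0"
    using log_lipschitzD(1)[OF ld, of 0 0] by simp
  ultimately have "0 < exp (2 * b / q) * integral {0..1} (branch_density q w n)"
    by linarith
  thus ?thesis
    by (simp add: zero_less_mult_iff)
qed

text \<open>The density of the first \<open>m\<close> factors is constant up to the factor \<open>exp (2 * b / q)\<close>, so that the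
  first \<open>m\<close> and the other \<open>n\<close> factors decouple up to this factor.\<close>

lemma quasi_additive_ln_density:
  assumes w: "log_lipschitz b w" and b: "0 \<le> b" and cont: "continuous_on UNIV w"
    and per: "\<And>x. w (x + 1) = w x" and q: "2 \<le> q" and pos: "\<And>x. 0 < w x"
  defines "Z \<equiv> \<lambda>n. integral {0..1} (branch_density q w n)"
  shows "\<bar>ln (Z (n + m)) - ln (Z n) - ln (Z m)\<bar> \<le> 2 * b / real q"
proof -
  define A where "A = 2 * b / real q"
  have A: "0 \<le> A"
    using b by (simp add: A_def)
  define G where "G x = (\<Prod>k<n. w (real (q ^ k) * x))" for x
  have G: "continuous_on {0..1} G"
    unfolding G_def by (intro continuous_intros continuous_on_compose2[OF cont]) auto
  have d: "continuous_on {0..1} (branch_density q w m)"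
    by (intro continuous_intros cont)
  note ld = log_lipschitz_branch_density[OF w b q, of m, folded A_def]
  have Z: "0 < Z k" for k
    unfolding Z_def by (rule integral_branch_density_pos[OF w b cont q])
  have Zn: "Z n = integral {0..1} G"
    using integral_prod_branch_density[OF cont per, of q n 0] q by (simp add: Z_def G_def[abs_def])
  have Znm: "Z (n + m) = integral {0..1} (\<lambda>x. G x * branch_density q w m x)"
    using integral_prod_branch_density[OF cont per, of q n m] q by (simp add: Z_def G_def[abs_def])
  have G0: "0 \<le> G x" for x
    unfolding G_def using pos by (intro prod_nonneg) (simp add: less_imp_le)
  have bnd: "exp (- A) * Z m \<le> branch_density q w m x" "branch_density q w m x \<le> exp A * Z m"
    if "0 \<le> x" "x \<le> 1" for x
    using log_lipschitz_integral_bounds[OF ld d A, of x] that by (simp_all add: Z_def)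
  note int = integrable_continuous_interval
  have "Z (n + m) \<le> integral {0..1} (\<lambda>x. G x * (exp A * Z m))"
    unfolding Znm
    by (intro integral_le int) (auto intro!: continuous_intros G d mult_left_mono G0 bnd)
  hence up: "Z (n + m) \<le> exp A * (Z n * Z m)"
    by (simp add: Zn ac_simps)
  have "integral {0..1} (\<lambda>x. G x * (exp (- A) * Z m)) \<le> Z (n + m)"
    unfolding Znm
    by (intro integral_le int) (auto intro!: continuous_intros G d mult_left_mono G0 bnd)
  hence lo: "exp (- A) * (Z n * Z m) \<le> Z (n + m)"
    by (simp add: Zn ac_simps)
  have "ln (Z (n + m)) \<le> ln (exp A * (Z n * Z m))" "ln (exp (- A) * (Z n * Z m)) \<le> ln (Z (n + m))"
    using up lo Z[of n] Z[of m] Z[of "n + m"] by (auto intro!: ln_mono)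
  thus ?thesis
    using Z[of n] Z[of m] unfolding A_def[symmetric] by (simp add: ln_mult)
qed

section \<open>Contraction by averaging operators\<close>

text \<open>Couple two measures of the same mass \<open>s\<close> independently.\<close>

lemma norm_diff_weighted_sums_le:
  fixes u v :: "'i \<Rightarrow> 'a::real_normed_field"
  assumes a: "\<And>i. i \<in> I \<Longrightarrow> 0 \<le> a i" "sum a I = s"
    and b: "\<And>i. i \<in> I \<Longrightarrow> 0 \<le> b i" "sum b I = s"
    and uv: "\<And>i j. i \<in> I \<Longrightarrow> j \<in> I \<Longrightarrow> norm (u i - v j) \<le> W" and I: "finite I"
  shows "norm ((\<Sum>i\<in>I. of_real (a i) * u i) - (\<Sum>i\<in>I. of_real (b i) * v i)) \<le> s * W"
proof (cases "s = 0")
  case True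
  hence "a i = 0" "b i = 0" if "i \<in> I" for i
    using a b I that by (auto simp: sum_nonneg_eq_0_iff)
  thus ?thesis
    using True by simp
next
  case False
  have s: "0 < s"
    using False a sum_nonneg[of I a] by auto
  let ?d = "(\<Sum>i\<in>I. of_real (a i) * u i) - (\<Sum>i\<in>I. of_real (b i) * v i)"
  have bs: "(\<Sum>j\<in>I. of_real (b j)) = (of_real s :: 'a)" "(\<Sum>j\<in>I. of_real (a j)) = (of_real s :: 'a)"
    using b a by (simp_all flip: of_real_sum)
  have "of_real s * ?d = (\<Sum>i\<in>I. of_real (a i) * u i) * (\<Sum>j\<in>I. of_real (b j))
      - (\<Sum>i\<in>I. of_real (a i)) * (\<Sum>j\<in>I. of_real (b j) * v j)"
    unfolding bs by (simp add: algebra_simps)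
  also have "\<dots> = (\<Sum>i\<in>I. \<Sum>j\<in>I. of_real (a i * b j) * (u i - v j))"
    unfolding sum_product sum_subtractf[symmetric]
    by (intro sum.cong refl) (simp add: algebra_simps)
  finally have "norm (of_real s * ?d) = norm (\<Sum>i\<in>I. \<Sum>j\<in>I. of_real (a i * b j) * (u i - v j))"
    by (rule arg_cong)
  hence "s * norm ?d = norm (\<Sum>i\<in>I. \<Sum>j\<in>I. of_real (a i * b j) * (u i - v j))"
    using s by (simp only: norm_mult norm_of_real abs_of_pos)
  also have "\<dots> \<le> (\<Sum>i\<in>I. \<Sum>j\<in>I. a i * b j * W)"
    using a b uv
    by (intro sum_norm_le) (auto simp: norm_mult intro!: mult_mono)
  also have "\<dots> = (\<Sum>i\<in>I. a i) * (\<Sum>j\<in>I. b j) * W"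
    by (simp only: sum_product) (simp only: sum_distrib_right)
  also have "\<dots> = s * (s * W)"
    using a b by simp
  finally show ?thesis
    using s by simp
qed

text \<open>In terms of \<open>y = exp (- B t / 2)\<close> this compares \<open>1 - y ^ 5\<close> with \<open>1 - y ^ 6\<close>.\<close>

lemma exp_contraction_rate:
  fixes B t :: real
  assumes "0 \<le> B" "0 \<le> t" "t \<le> 1"
  shows "1 - exp (- (5/2 * B * t)) \<le> (1 - exp (- (5/2 * B)) / 6) * (1 - exp (- (3 * B * t)))"
proof -
  define y where "y = exp (- (B * t / 2))"
  define m where "m = exp (- (5/2 * B))"
  have y5: "exp (- (5/2 * B * t)) = y ^ 5" and y6: "exp (- (3 * B * t)) = y ^ 6"
    unfolding y_def by (simp_all flip: exp_of_nat_mult add: algebra_simps)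
  have y: "0 < y" "y \<le> 1"
    using assms by (simp_all add: y_def)
  have "B * t \<le> B * 1"
    using assms by (intro mult_left_mono) auto
  hence my: "m \<le> y ^ 5"
    unfolding y5[symmetric] m_def by (simp add: algebra_simps)
  have "1 + real 6 * (y - 1) \<le> (1 + (y - 1)) ^ 6"
    using y by (intro Bernoulli_inequality) auto
  hence "(1 - y ^ 6) / 6 \<le> 1 - y"
    by simp
  hence "m * ((1 - y ^ 6) / 6) \<le> y ^ 5 * (1 - y)"
    using my y by (intro mult_mono) (auto simp: m_def power_le_one)
  moreover have "1 - y ^ 5 = (1 - y ^ 6) - y ^ 5 * (1 - y)"
    by (simp add: eval_nat_numeral algebra_simps)
  moreover have "(1 - m / 6) * (1 - y ^ 6) = (1 - y ^ 6) - m * ((1 - y ^ 6) / 6)"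
    by (simp add: field_simps)
  ultimately show ?thesis
    unfolding y5 y6 m_def[symmetric] by linarith
qed

text \<open>Oscillations are measured against the modulus \<open>t \<mapsto> 1 - exp (- 3 B t)\<close>, for which one step already
  contracts.  Two points at distance \<open>t\<close> share, branch by branch, the fraction \<open>e = exp (- B t)\<close> of their
  weights.  On the shared part the distance shrinks to \<open>t / q \<le> t / 2\<close>, which contributes
  \<open>e * (1 - exp (- 3/2 B t))\<close>; the rest, of mass \<open>1 - e\<close>, contributes at most \<open>1 - e\<close>.  The two add up to
  \<open>1 - exp (- 5/2 B t)\<close>, which is less than \<open>1 - exp (- 3 B t)\<close> by a factor bounded away from \<open>1\<close>.  A
  plain Lipschitz seminorm would not contract when \<open>B\<close> is large.\<close>

lemma markov_contraction:
  fixes g :: "real \<Rightarrow> 'a::real_normed_field"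
  assumes q: "2 \<le> q" and B: "0 \<le> B" and V: "0 \<le> V"
    and xy: "x \<in> {0..1}" "y \<in> {0..1}"
    and px: "\<And>j. j < q \<Longrightarrow> 0 \<le> p j x" "(\<Sum>j<q. p j x) = 1" and py: "(\<Sum>j<q. p j y) = 1"
    and low: "\<And>j. j < q \<Longrightarrow> exp (- (B * \<bar>x - y\<bar>)) * p j x \<le> p j y"
    and g: "\<And>u v. u \<in> {0..1} \<Longrightarrow> v \<in> {0..1} \<Longrightarrow> norm (g u - g v) \<le> V * (1 - exp (- (3 * B * \<bar>u - v\<bar>)))"
  shows "norm ((\<Sum>j<q. of_real (p j x) * g ((x + real j) / real q))
      - (\<Sum>j<q. of_real (p j y) * g ((y + real j) / real q)))
    \<le> (1 - exp (- (5/2 * B)) / 6) * V * (1 - exp (- (3 * B * \<bar>x - y\<bar>)))"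
proof -
  define t where "t = \<bar>x - y\<bar>"
  define e where "e = exp (- (B * t))"
  have t: "0 \<le> t" "t \<le> 1"
    using xy by (auto simp: t_def)
  have e: "0 < e" "e \<le> 1"
    using B t by (auto simp: e_def)
  define X Y where "X j = g ((x + real j) / real q)" and "Y j = g ((y + real j) / real q)" for j
  let ?a = "\<lambda>j. (1 - e) * p j x" and ?b = "\<lambda>j. p j y - e * p j x"
  have near: "norm (X j - Y j) \<le> V * (1 - exp (- (3/2 * B * t)))" if j: "j < q" for j
  proof -
    have "t / real q \<le> t / 2"
      using q t by (intro divide_left_mono) auto
    hence "3 * B * (t / real q) \<le> 3 * B * (t / 2)"
      using B by (intro mult_left_mono) auto
    hence "1 - exp (- (3 * B * (t / real q))) \<le> 1 - exp (- (3/2 * B * t))"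
      by simp
    hence "V * (1 - exp (- (3 * B * (t / real q)))) \<le> V * (1 - exp (- (3/2 * B * t)))"
      using V by (rule mult_left_mono)
    moreover have "norm (X j - Y j) \<le> V * (1 - exp (- (3 * B * (t / real q))))"
      using g[OF branch_in_unit_interval[OF xy(1) j] branch_in_unit_interval[OF xy(2) j]]
      unfolding X_def Y_def branch_dist t_def .
    ultimately show ?thesis
      by linarith
  qed
  have far: "norm (X i - Y j) \<le> V" if ij: "i < q" "j < q" for i j
  proof -
    have "norm (X i - Y j) \<le> V * (1 - exp (- (3 * B * \<bar>(x + real i) / real q - (y + real j) / real q\<bar>)))"
      unfolding X_def Y_def using branch_in_unit_interval xy ij by (intro g) auto
    also have "\<dots> \<le> V * 1"
      using V by (intro mult_left_mono) auto
    finally show ?thesis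
      by simp
  qed
  have "norm (\<Sum>j<q. of_real (e * p j x) * (X j - Y j))
      \<le> (\<Sum>j<q. e * p j x * (V * (1 - exp (- (3/2 * B * t)))))"
    using e px near by (intro sum_norm_le) (auto simp: norm_mult intro!: mult_mono)
  also have "\<dots> = (\<Sum>j<q. p j x) * (e * (V * (1 - exp (- (3/2 * B * t)))))"
    by (subst sum_distrib_right) (simp add: ac_simps)
  finally have 1: "norm (\<Sum>j<q. of_real (e * p j x) * (X j - Y j)) \<le> V * (e * (1 - exp (- (3/2 * B * t))))"
    using px by (simp add: ac_simps)
  have 2: "norm ((\<Sum>j<q. of_real (?a j) * X j) - (\<Sum>j<q. of_real (?b j) * Y j)) \<le> (1 - e) * V"
  proof (rule norm_diff_weighted_sums_le)
    show "sum ?a {..<q} = 1 - e"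
      using px by (simp flip: sum_distrib_left)
    show "sum ?b {..<q} = 1 - e"
      using px py by (simp add: sum_subtractf flip: sum_distrib_left)
  qed (use e px low far in \<open>auto simp: e_def t_def\<close>)
  have "(\<Sum>j<q. of_real (p j x) * X j) - (\<Sum>j<q. of_real (p j y) * Y j)
      = (\<Sum>j<q. of_real (e * p j x) * (X j - Y j))
        + ((\<Sum>j<q. of_real (?a j) * X j) - (\<Sum>j<q. of_real (?b j) * Y j))"
    by (simp add: algebra_simps sum.distrib sum_subtractf)
  hence "norm ((\<Sum>j<q. of_real (p j x) * X j) - (\<Sum>j<q. of_real (p j y) * Y j))
      \<le> V * (e * (1 - exp (- (3/2 * B * t)))) + (1 - e) * V"
    using norm_triangle_mono[OF 1 2] by simp
  also have "\<dots> = V * (1 - e * exp (- (3/2 * B * t)))"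
    by (simp add: algebra_simps)
  also have "e * exp (- (3/2 * B * t)) = exp (- (5/2 * B * t))"
    unfolding e_def by (simp flip: exp_add add: algebra_simps)
  also have "V * (1 - exp (- (5/2 * B * t)))
      \<le> V * ((1 - exp (- (5/2 * B)) / 6) * (1 - exp (- (3 * B * t))))"
    using exp_contraction_rate[OF B t] V by (rule mult_left_mono)
  finally show ?thesis
    unfolding X_def Y_def t_def by (simp add: ac_simps)
qed

section \<open>Partition functions near a positive weight\<close>

text \<open>The cone of functions that deviate from their value at \<open>0\<close> by at most a fraction \<open>\<eta>\<close> of it is
  invariant: the averaging step multiplies the deviation by \<open>1 - 4 * \<eta>\<close>, whereas the value at \<open>0\<close> drifts
  only by a factor \<open>1 - \<eta> + O(\<eta>\<^sup>2)\<close>.  This leaves room for a perturbation \<open>E\<close> of size \<open>\<eta>\<^sup>2\<close>.\<close>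

lemma perturbed_markov_cone:
  fixes g g' :: "real \<Rightarrow> complex"
  assumes q: "2 \<le> q" and B: "0 \<le> B"
  defines "\<eta> \<equiv> exp (- (5/2 * B)) / 24"
  assumes p: "\<And>j x. j < q \<Longrightarrow> x \<in> {0..1} \<Longrightarrow> 0 \<le> p j x" "\<And>x. x \<in> {0..1} \<Longrightarrow> (\<Sum>j<q. p j x) = 1"
    and low: "\<And>j x y. j < q \<Longrightarrow> x \<in> {0..1} \<Longrightarrow> y \<in> {0..1} \<Longrightarrow> exp (- (B * \<bar>x - y\<bar>)) * p j x \<le> p j y"
    and E: "\<And>x. x \<in> {0..1} \<Longrightarrow> norm (E x - 1) \<le> \<eta>\<^sup>2"
      "\<And>x y. x \<in> {0..1} \<Longrightarrow> y \<in> {0..1} \<Longrightarrow> norm (E x - E y) \<le> \<eta>\<^sup>2 * (1 - exp (- (3 * B * \<bar>x - y\<bar>)))"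
    and g0: "g 0 \<noteq> 0"
    and g: "\<And>x y. x \<in> {0..1} \<Longrightarrow> y \<in> {0..1} \<Longrightarrow> norm (g x - g y) \<le> \<eta> * norm (g 0) * (1 - exp (- (3 * B * \<bar>x - y\<bar>)))"
    and g': "\<And>x. x \<in> {0..1} \<Longrightarrow> g' x = (\<Sum>j<q. of_real (p j x) * (E ((x + real j) / real q) * g ((x + real j) / real q)))"
  shows "g' 0 \<noteq> 0" "norm (g' 0 - g 0) \<le> 2 * \<eta> * norm (g 0)"
    "x \<in> {0..1} \<Longrightarrow> y \<in> {0..1} \<Longrightarrow> norm (g' x - g' y) \<le> \<eta> * norm (g' 0) * (1 - exp (- (3 * B * \<bar>x - y\<bar>)))"
proof -
  define a where "a = norm (g 0)"
  have a: "0 < a"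
    using g0 by (simp add: a_def)
  have \<eta>: "0 < \<eta>" "\<eta> \<le> 1 / 24"
    using B by (simp_all add: \<eta>_def)
  have \<eta>2: "\<eta>\<^sup>2 \<le> \<eta> / 24"
    using mult_left_mono[OF \<eta>(2), of \<eta>] \<eta> by (simp add: power2_eq_square)
  have D: "0 \<le> 1 - exp (- (3 * B * \<bar>x - y\<bar>))" "1 - exp (- (3 * B * \<bar>x - y\<bar>)) \<le> 1" for x y :: real
    using B by simp_all
  have osc: "norm (g x - g 0) \<le> \<eta> * a" if x: "x \<in> {0..1}" for x
  proof -
    have "norm (g x - g 0) \<le> \<eta> * a * (1 - exp (- (3 * B * \<bar>x - 0\<bar>)))"
      unfolding a_def using x by (intro g) auto
    also have "\<dots> \<le> \<eta> * a * 1"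
      using \<eta> a D by (intro mult_left_mono) auto
    finally show ?thesis
      by simp
  qed
  have size: "norm (g x) \<le> (1 + \<eta>) * a" if x: "x \<in> {0..1}" for x
    using osc[OF x] norm_triangle_sub[of "g x" "g 0"] by (simp add: a_def algebra_simps)
  have Esize: "norm (E x) \<le> 1 + \<eta>\<^sup>2" if x: "x \<in> {0..1}" for x
    using E(1)[OF x] norm_triangle_sub[of "E x" 1] by simp
  define V where "V = ((1 + \<eta>\<^sup>2) * \<eta> + (1 + \<eta>) * \<eta>\<^sup>2) * a"
  have V: "0 \<le> V"
    using \<eta> a by (simp add: V_def)
  have Eg: "norm (E x * g x - E y * g y) \<le> V * (1 - exp (- (3 * B * \<bar>x - y\<bar>)))"
    if xy: "x \<in> {0..1}" "y \<in> {0..1}" for x y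
  proof -
    let ?D = "1 - exp (- (3 * B * \<bar>x - y\<bar>))"
    have "E x * g x - E y * g y = E x * (g x - g y) + g y * (E x - E y)"
      by (simp add: algebra_simps)
    hence "norm (E x * g x - E y * g y) \<le> norm (E x) * norm (g x - g y) + norm (g y) * norm (E x - E y)"
      using norm_triangle_ineq[of "E x * (g x - g y)" "g y * (E x - E y)"]
      by (simp only: norm_mult)
    also have "\<dots> \<le> (1 + \<eta>\<^sup>2) * (\<eta> * a * ?D) + ((1 + \<eta>) * a) * (\<eta>\<^sup>2 * ?D)"
      using Esize[OF xy(1)] g[OF xy] size[OF xy(2)] E(2)[OF xy] \<eta> a
      by (intro add_mono mult_mono) (auto simp: a_def)
    also have "\<dots> = V * ?D"
      by (simp add: V_def algebra_simps)
    finally show ?thesis .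
  qed
  have "g' 0 - g 0 = (\<Sum>j<q. of_real (p j 0) * (E (real j / real q) * g (real j / real q) - g 0))"
  proof -
    have "g 0 = (\<Sum>j<q. of_real (p j 0)) * g 0"
      using p(2)[of 0] by (simp flip: of_real_sum)
    also have "\<dots> = (\<Sum>j<q. of_real (p j 0) * g 0)"
      by (rule sum_distrib_right)
    finally have g0_eq: "g 0 = (\<Sum>j<q. of_real (p j 0) * g 0)" .
    have "g' 0 - g 0 = (\<Sum>j<q. of_real (p j 0) * (E (real j / real q) * g (real j / real q)))
        - (\<Sum>j<q. of_real (p j 0) * g 0)"
      using g'[of 0] by (subst g0_eq[symmetric]) simp
    thus ?thesis
      by (simp add: sum_subtractf right_diff_distrib)
  qed
  also have "norm \<dots> \<le> (\<Sum>j<q. p j 0 * ((\<eta>\<^sup>2 * (1 + \<eta>) + \<eta>) * a))"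
  proof (intro sum_norm_le)
    fix j
    assume "j \<in> {..<q}"
    hence j: "j < q"
      by simp
    define x where "x = real j / real q"
    have x: "x \<in> {0..1}"
      using branch_in_unit_interval[of 0 j q] j by (simp add: x_def)
    have "E x * g x - g 0 = (E x - 1) * g x + (g x - g 0)"
      by (simp add: algebra_simps)
    hence "norm (E x * g x - g 0) \<le> norm (E x - 1) * norm (g x) + norm (g x - g 0)"
      using norm_triangle_ineq[of "(E x - 1) * g x" "g x - g 0"] by (simp only: norm_mult)
    also have "\<dots> \<le> \<eta>\<^sup>2 * ((1 + \<eta>) * a) + \<eta> * a"
      using E(1)[OF x] size[OF x] osc[OF x] by (intro add_mono mult_mono) auto
    finally have "norm (E x * g x - g 0) \<le> (\<eta>\<^sup>2 * (1 + \<eta>) + \<eta>) * a"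
      by (simp add: algebra_simps)
    thus "norm (of_real (p j 0) * (E (real j / real q) * g (real j / real q) - g 0))
        \<le> p j 0 * ((\<eta>\<^sup>2 * (1 + \<eta>) + \<eta>) * a)"
      using p(1)[OF j, of 0] by (simp add: norm_mult x_def[symmetric] mult_left_mono)
  qed
  also have "\<dots> = (\<eta>\<^sup>2 * (1 + \<eta>) + \<eta>) * a"
    using p(2)[of 0] by (simp flip: sum_distrib_right)
  finally have drift: "norm (g' 0 - g 0) \<le> (\<eta>\<^sup>2 * (1 + \<eta>) + \<eta>) * a" .
  have coeff: "\<eta>\<^sup>2 * (1 + \<eta>) + \<eta> \<le> 2 * \<eta>"
  proof -
    have "\<eta>\<^sup>2 * (1 + \<eta>) \<le> (\<eta> / 24) * (1 + 1 / 24)"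
      using \<eta> \<eta>2 by (intro mult_mono) auto
    thus ?thesis
      using \<eta> by simp
  qed
  show drift2: "norm (g' 0 - g 0) \<le> 2 * \<eta> * norm (g 0)"
    using drift mult_right_mono[OF coeff, of a] a unfolding a_def by linarith
  have lower: "(1 - (\<eta>\<^sup>2 * (1 + \<eta>) + \<eta>)) * a \<le> norm (g' 0)"
    using drift norm_triangle_sub[of "g 0" "g' 0"] by (simp add: norm_minus_commute a_def algebra_simps)
  have "0 < (1 - (\<eta>\<^sup>2 * (1 + \<eta>) + \<eta>)) * a"
    using a coeff \<eta> by (intro mult_pos_pos) auto
  with lower show "g' 0 \<noteq> 0"
    by auto
  have rate: "(1 - 4 * \<eta>) * V \<le> \<eta> * norm (g' 0)"
  proof -
    have "(1 - 4 * \<eta>) * ((1 + \<eta>\<^sup>2) * \<eta> + (1 + \<eta>) * \<eta>\<^sup>2) \<le> \<eta> * (1 - (\<eta>\<^sup>2 * (1 + \<eta>) + \<eta>))"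
    proof -
      have "\<eta> * (1 - (\<eta>\<^sup>2 * (1 + \<eta>) + \<eta>)) - (1 - 4 * \<eta>) * ((1 + \<eta>\<^sup>2) * \<eta> + (1 + \<eta>) * \<eta>\<^sup>2)
          = \<eta>\<^sup>2 * (2 + \<eta> + 7 * \<eta>\<^sup>2)"
        by (simp add: algebra_simps power2_eq_square)
      moreover have "0 \<le> \<eta>\<^sup>2 * (2 + \<eta> + 7 * \<eta>\<^sup>2)"
        using \<eta> by simp
      ultimately show ?thesis
        by linarith
    qed
    hence "(1 - 4 * \<eta>) * V \<le> \<eta> * (1 - (\<eta>\<^sup>2 * (1 + \<eta>) + \<eta>)) * a"
      unfolding V_def using a by (simp only: mult.assoc[symmetric] mult_right_mono less_imp_le)
    also have "\<dots> \<le> \<eta> * norm (g' 0)"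
      using mult_left_mono[OF lower, of \<eta>] \<eta> by (simp add: mult.assoc)
    finally show ?thesis .
  qed
  show "norm (g' x - g' y) \<le> \<eta> * norm (g' 0) * (1 - exp (- (3 * B * \<bar>x - y\<bar>)))"
    if xy: "x \<in> {0..1}" "y \<in> {0..1}" for x y
  proof -
    have "norm (g' x - g' y) \<le> (1 - exp (- (5/2 * B)) / 6) * V * (1 - exp (- (3 * B * \<bar>x - y\<bar>)))"
      unfolding g'[OF xy(1)] g'[OF xy(2)]
      by (rule markov_contraction[where g = "\<lambda>x. E x * g x", OF q B V xy]) (use p low xy Eg in auto)
    also have "1 - exp (- (5/2 * B)) / 6 = 1 - 4 * \<eta>"
      by (simp add: \<eta>_def)
    also have "(1 - 4 * \<eta>) * V * (1 - exp (- (3 * B * \<bar>x - y\<bar>)))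
        \<le> \<eta> * norm (g' 0) * (1 - exp (- (3 * B * \<bar>x - y\<bar>)))"
      using rate D(1) by (rule mult_right_mono)
    finally show ?thesis .
  qed
qed

text \<open>The perturbed densities are compared with the unperturbed ones through their quotient \<open>g n\<close>.  The
  recursion for \<open>g n\<close> is an averaging with nonnegative weights \<open>p n\<close> of total mass \<open>1\<close>, whose logarithms
  have Lipschitz constant at most \<open>(b + c) / q + c \<le> 2 * b\<close>, where \<open>c = 2 * b / q\<close>.  As
  \<open>g 0\<close> is the constant \<open>1\<close>, the sequence starts in the invariant cone, so that the estimates hold
  for all \<open>n\<close>.\<close>

lemma perturbed_density_cone:
  fixes E :: "real \<Rightarrow> complex"
  assumes w: "log_lipschitz b w" and b: "0 \<le> b" and q: "2 \<le> q"
  defines "B \<equiv> 2 * b + 1"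
  defines "\<eta> \<equiv> exp (- (5/2 * B)) / 24"
  assumes E: "\<And>x. x \<in> {0..1} \<Longrightarrow> norm (E x - 1) \<le> \<eta>\<^sup>2"
      "\<And>x y. x \<in> {0..1} \<Longrightarrow> y \<in> {0..1} \<Longrightarrow> norm (E x - E y) \<le> \<eta>\<^sup>2 * (1 - exp (- (3 * B * \<bar>x - y\<bar>)))"
  defines "g \<equiv> \<lambda>n x. branch_density q (\<lambda>x. of_real (w x) * E x) n x / of_real (branch_density q w n x)"
  shows "g n 0 \<noteq> 0"
    and "norm (g (Suc n) 0 - g n 0) \<le> 2 * \<eta> * norm (g n 0)"
    and "\<And>x. x \<in> {0..1} \<Longrightarrow> norm (g n x - g n 0) \<le> \<eta> * norm (g n 0)"
proof -
  let ?h = "\<lambda>n. branch_density q w n" and ?H = "\<lambda>n. branch_density q (\<lambda>x. of_real (w x) * E x) n"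
  let ?D = "\<lambda>x y::real. 1 - exp (- (3 * B * \<bar>x - y\<bar>))"
  have B: "0 \<le> B"
    using b by (simp add: B_def)
  have \<eta>: "0 < \<eta>"
    by (simp add: \<eta>_def)
  define c where "c = 2 * b / real q"
  have c: "0 \<le> c" "c \<le> b"
    using b q by (auto simp: c_def field_simps mult_left_mono)
  have h: "log_lipschitz c (?h n)" for n
    unfolding c_def by (rule log_lipschitz_branch_density[OF w b q])
  have hpos: "0 < ?h n x" if "x \<in> {0..1}" for n x
    using log_lipschitzD(1)[OF h that that] .
  define num where "num n x = w x * ?h n x" for n x
  have num: "log_lipschitz (b + c) (num n)" for n
    unfolding num_def by (rule log_lipschitz_mult[OF w h])
  define p where "p n j x = num n ((x + real j) / real q) / (real q * ?h (Suc n) x)" for n j x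
  have h_Suc: "real q * ?h (Suc n) x = (\<Sum>j<q. num n ((x + real j) / real q))" for n x
    using q by (simp add: branch_mean_def num_def)
  have p: "0 \<le> p n j x" if "j < q" "x \<in> {0..1}" for n j x
    unfolding p_def using hpos[OF that(2), of "Suc n"] branch_in_unit_interval[OF that(2,1)]
      log_lipschitzD(1)[OF num]
    by (intro divide_nonneg_nonneg) (auto simp: less_imp_le simp del: branch_density.simps)
  have p1: "(\<Sum>j<q. p n j x) = 1" if "x \<in> {0..1}" for n x
    unfolding p_def sum_divide_distrib[symmetric] h_Suc[symmetric]
    using hpos[OF that, of "Suc n"] q by simp
  have low: "exp (- (B * \<bar>x - y\<bar>)) * p n j x \<le> p n j y"
    if j: "j < q" and xy: "x \<in> {0..1}" "y \<in> {0..1}" for n j x y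
  proof -
    let ?x = "(x + real j) / real q" and ?y = "(y + real j) / real q"
    have numpos: "0 < num n ?y"
      using log_lipschitzD(1)[OF num] branch_in_unit_interval[OF xy(2) j] by blast
    have "(b + c) / real q + c \<le> B"
    proof -
      have "(b + c) / real q \<le> (b + c) / 2"
        using b c q by (intro divide_left_mono) auto
      also have "\<dots> \<le> b"
        using c by simp
      finally have "(b + c) / real q + c \<le> b + c"
        by (rule add_right_mono)
      thus ?thesis
        using c by (simp add: B_def)
    qed
    hence rate: "(b + c) / real q * \<bar>x - y\<bar> + c * \<bar>x - y\<bar> \<le> B * \<bar>x - y\<bar>"
      by (metis distrib_right mult_right_mono abs_ge_zero)
    have "num n ?x * (real q * ?h (Suc n) y)
        \<le> (exp ((b + c) / real q * \<bar>x - y\<bar>) * num n ?y) * (real q * (exp (c * \<bar>x - y\<bar>) * ?h (Suc n) x))"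
      using log_lipschitz_branch[OF num xy j] log_lipschitzD(2)[OF h xy(2,1)] numpos hpos xy
      by (intro mult_mono) (auto simp: abs_minus_commute less_imp_le simp del: branch_density.simps)
    also have "\<dots> = exp ((b + c) / real q * \<bar>x - y\<bar> + c * \<bar>x - y\<bar>) * (num n ?y * (real q * ?h (Suc n) x))"
      by (simp add: exp_add ac_simps del: branch_density.simps)
    also have "\<dots> \<le> exp (B * \<bar>x - y\<bar>) * (num n ?y * (real q * ?h (Suc n) x))"
      using rate numpos hpos[OF xy(1), of "Suc n"]
      by (intro mult_right_mono) (auto simp: less_imp_le simp del: branch_density.simps)
    finally show ?thesis
      unfolding p_def using q hpos[OF xy(1), of "Suc n"] hpos[OF xy(2), of "Suc n"]
      by (simp add: exp_minus field_simps del: branch_density.simps)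
  qed
  have g_Suc: "g (Suc n) x = (\<Sum>j<q. of_real (p n j x) * (E ((x + real j) / real q) * g n ((x + real j) / real q)))"
    if x: "x \<in> {0..1}" for n x
  proof -
    have "g (Suc n) x = (\<Sum>j<q. of_real (w ((x + real j) / real q)) * E ((x + real j) / real q)
        * ?H n ((x + real j) / real q)) / (of_nat q * of_real (?h (Suc n) x))"
      unfolding g_def by (simp add: branch_mean_def)
    also have "\<dots> = (\<Sum>j<q. of_real (p n j x) * (E ((x + real j) / real q) * g n ((x + real j) / real q)))"
      unfolding sum_divide_distrib
    proof (intro sum.cong refl)
      fix j
      assume "j \<in> {..<q}"
      hence "?h n ((x + real j) / real q) \<noteq> 0"
        using hpos[OF branch_in_unit_interval[OF x], of j q n] by auto
      thus "of_real (w ((x + real j) / real q)) * E ((x + real j) / real q) * ?H n ((x + real j) / real q)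
          / (of_nat q * of_real (?h (Suc n) x))
        = of_real (p n j x) * (E ((x + real j) / real q) * g n ((x + real j) / real q))"
        unfolding p_def g_def num_def by (simp del: branch_density.simps)
    qed
    finally show ?thesis .
  qed
  note step = perturbed_markov_cone[where E = E and B = B and q = q, folded \<eta>_def, OF q B p p1 low E]
  have inv: "g n 0 \<noteq> 0 \<and> (\<forall>x\<in>{0..1}. \<forall>y\<in>{0..1}. norm (g n x - g n y) \<le> \<eta> * norm (g n 0) * ?D x y)" for n
  proof (induction n)
    case 0
    show ?case
      using \<eta> B by (simp add: g_def)
  next
    case (Suc n)
    show ?case
      using step(1)[where g = "g n" and g' = "g (Suc n)"]
        step(3)[where g = "g n" and g' = "g (Suc n)"] Suc g_Suc by blast
  qed
  show "g n 0 \<noteq> 0"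
    using inv by blast
  show "norm (g (Suc n) 0 - g n 0) \<le> 2 * \<eta> * norm (g n 0)"
    using step(2)[where g = "g n" and g' = "g (Suc n)"] inv[of n] g_Suc by blast
  show "norm (g n x - g n 0) \<le> \<eta> * norm (g n 0)" if x: "x \<in> {0..1}" for x
  proof -
    have "norm (g n x - g n 0) \<le> \<eta> * norm (g n 0) * ?D x 0"
      using inv[of n] x by (metis atLeastAtMost_iff order_refl zero_le_one)
    also have "\<dots> \<le> \<eta> * norm (g n 0) * 1"
      using \<eta> by (intro mult_left_mono) auto
    finally show ?thesis
      by simp
  qed
qed

text \<open>By \<open>perturbed_density_cone\<close>, \<open>Z n\<close> is \<open>\<zeta> n * g n 0\<close> up to a relative error \<open>\<eta>\<close>, and the numbers
  \<open>g n 0\<close> and \<open>g (n + 1) 0\<close> differ by a relative error \<open>2 * \<eta>\<close>.\<close>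

lemma perturbed_partition_ratio:
  fixes E :: "real \<Rightarrow> complex"
  assumes w: "log_lipschitz b w" "continuous_on UNIV w" and b: "0 \<le> b" and q: "2 \<le> q"
    and contE: "continuous_on UNIV E"
  defines "B \<equiv> 2 * b + 1"
  defines "\<eta> \<equiv> exp (- (5/2 * B)) / 24"
  assumes E: "\<And>x. x \<in> {0..1} \<Longrightarrow> norm (E x - 1) \<le> \<eta>\<^sup>2"
      "\<And>x y. x \<in> {0..1} \<Longrightarrow> y \<in> {0..1} \<Longrightarrow> norm (E x - E y) \<le> \<eta>\<^sup>2 * (1 - exp (- (3 * B * \<bar>x - y\<bar>)))"
  defines "\<zeta> \<equiv> \<lambda>n. integral {0..1} (branch_density q w n)"
  defines "Z \<equiv> \<lambda>n. integral {0..1} (branch_density q (\<lambda>x. of_real (w x) * E x) n)"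
  shows "Z n \<noteq> 0" and "norm (Z (Suc n) / Z n / of_real (\<zeta> (Suc n) / \<zeta> n) - 1) < 1 / 2"
proof -
  let ?h = "\<lambda>n. branch_density q w n" and ?H = "\<lambda>n. branch_density q (\<lambda>x. of_real (w x) * E x) n"
  define g where "g n x = ?H n x / of_real (?h n x)" for n x
  have \<eta>: "0 < \<eta>" "\<eta> \<le> 1 / 24"
    using b by (simp_all add: \<eta>_def B_def)
  note cone_raw = perturbed_density_cone[OF w(1) b q, of E, folded B_def, folded \<eta>_def]
  have cone: "g n 0 \<noteq> 0" "norm (g (Suc n) 0 - g n 0) \<le> 2 * \<eta> * norm (g n 0)"
    "x \<in> {0..1} \<Longrightarrow> norm (g n x - g n 0) \<le> \<eta> * norm (g n 0)" for n x
    unfolding g_def by (rule cone_raw; use E in blast)+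
  have \<zeta>: "0 < \<zeta> n" for n
    unfolding \<zeta>_def by (rule integral_branch_density_pos[OF w(1) b w(2) q])
  have hpos: "0 < ?h n x" if "x \<in> {0..1}" for n x
    using log_lipschitzD(1)[OF log_lipschitz_branch_density[OF w(1) b q] that that] .
  define u where "u n = Z n / (of_real (\<zeta> n) * g n 0)" for n
  have u: "norm (u n - 1) \<le> \<eta>" for n
  proof -
    have int: "?H n integrable_on {0..1}" "?h n integrable_on {0..1}"
      by (intro integrable_continuous_interval continuous_intros w contE)+
    have inth: "((\<lambda>x. of_real (?h n x)) has_integral of_real (\<zeta> n)) {0..1}"
      unfolding \<zeta>_def using has_integral_linear[OF integrable_integral[OF int(2)] bounded_linear_of_real]
      by (simp add: o_def)
    have "((\<lambda>x. ?H n x - g n 0 * of_real (?h n x)) has_integral Z n - g n 0 * of_real (\<zeta> n)) {0..1}"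
      unfolding Z_def
      by (intro has_integral_diff has_integral_mult_right integrable_integral int inth)
    moreover have "((\<lambda>x. \<eta> * norm (g n 0) * ?h n x) has_integral \<eta> * norm (g n 0) * \<zeta> n) {0..1}"
      unfolding \<zeta>_def by (intro has_integral_mult_right integrable_integral int)
    moreover have "norm (?H n x - g n 0 * of_real (?h n x)) \<le> \<eta> * norm (g n 0) * ?h n x"
      if x: "x \<in> {0..1}" for x
    proof -
      have "?H n x - g n 0 * of_real (?h n x) = (g n x - g n 0) * of_real (?h n x)"
        using hpos[OF x, of n] by (simp add: g_def[of n x] algebra_simps)
      hence "norm (?H n x - g n 0 * of_real (?h n x)) = norm (g n x - g n 0) * ?h n x"
        using hpos[OF x, of n] by (simp add: norm_mult)
      also have "\<dots> \<le> \<eta> * norm (g n 0) * ?h n x"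
        using cone(3)[OF x, of n] hpos[OF x, of n] by (intro mult_right_mono) auto
      finally show ?thesis .
    qed
    ultimately have "norm (Z n - g n 0 * of_real (\<zeta> n)) \<le> \<eta> * norm (g n 0) * \<zeta> n"
      by (metis (no_types, lifting) has_integral_integrable integral_norm_bound_integral integral_unique)
    hence "norm (Z n - g n 0 * of_real (\<zeta> n)) / (\<zeta> n * norm (g n 0)) \<le> \<eta>"
      using \<zeta>[of n] cone(1)[of n] by (simp add: divide_le_eq ac_simps)
    moreover have "u n - 1 = (Z n - g n 0 * of_real (\<zeta> n)) / (of_real (\<zeta> n) * g n 0)"
      using \<zeta>[of n] cone(1)[of n] by (simp add: u_def field_simps)
    ultimately show ?thesis
      using \<zeta>[of n] by (simp add: norm_divide norm_mult)
  qed
  have u_lower: "23 / 24 \<le> norm (u n)" for n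
    using u[of n] \<eta> norm_triangle_sub[of 1 "u n"] by (simp add: norm_minus_commute)
  hence u0: "u n \<noteq> 0" for n
    by (metis norm_zero not_le divide_pos_pos zero_less_numeral)
  thus "Z n \<noteq> 0"
    by (auto simp: u_def)
  have u_upper: "norm (u n) \<le> 25 / 24" for n
    using u[of n] \<eta> norm_triangle_sub[of "u n" 1] by simp
  define r where "r = g (Suc n) 0 / g n 0"
  have "r - 1 = (g (Suc n) 0 - g n 0) / g n 0"
    using cone(1)[of n] by (simp add: r_def field_simps)
  moreover have "norm (g (Suc n) 0 - g n 0) \<le> 1 / 12 * norm (g n 0)"
    using cone(2)[of n] mult_right_mono[OF \<eta>(2) norm_ge_zero[of "g n 0"]] by linarith
  ultimately have r: "norm (r - 1) \<le> 1 / 12"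
    using cone(1)[of n] by (simp add: norm_divide divide_le_eq)
  have "Z (Suc n) / Z n / of_real (\<zeta> (Suc n) / \<zeta> n) = r * u (Suc n) / u n"
    using \<zeta>[of n] \<zeta>[of "Suc n"] cone(1)[of n] cone(1)[of "Suc n"]
    by (simp add: u_def r_def field_simps)
  hence "Z (Suc n) / Z n / of_real (\<zeta> (Suc n) / \<zeta> n) - 1
      = ((r - 1) * u (Suc n) + ((u (Suc n) - 1) - (u n - 1))) / u n"
    using u0[of n] by (simp add: field_simps)
  hence "norm (Z (Suc n) / Z n / of_real (\<zeta> (Suc n) / \<zeta> n) - 1)
      = norm ((r - 1) * u (Suc n) + ((u (Suc n) - 1) - (u n - 1))) / norm (u n)"
    by (simp only: norm_divide)
  also have "\<dots> \<le> (1 / 12 * (25 / 24) + (1 / 24 + 1 / 24)) / (23 / 24)"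
  proof (rule frac_le)
    have "norm ((r - 1) * u (Suc n)) \<le> 1 / 12 * (25 / 24)"
      unfolding norm_mult using r u_upper[of "Suc n"] by (intro mult_mono) auto
    moreover have "norm ((u (Suc n) - 1) - (u n - 1)) \<le> 1 / 24 + 1 / 24"
      using norm_triangle_ineq4[of "u (Suc n) - 1" "u n - 1"] u[of n] u[of "Suc n"] \<eta> by linarith
    ultimately show "norm ((r - 1) * u (Suc n) + ((u (Suc n) - 1) - (u n - 1))) \<le> 1 / 12 * (25 / 24) + (1 / 24 + 1 / 24)"
      by (rule norm_triangle_mono)
  qed (use u_lower in auto)
  also have "\<dots> < 1 / 2"
    by simp
  finally show "norm (Z (Suc n) / Z n / of_real (\<zeta> (Suc n) / \<zeta> n) - 1) < 1 / 2" .
qed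

section \<open>The moment generating function of a geometric lacunary sum\<close>

text \<open>The type is left open because the function is needed for real and for complex arguments.\<close>

definition geometric_mgf :: "nat \<Rightarrow> (real \<Rightarrow> real) \<Rightarrow> nat \<Rightarrow> 'a \<Rightarrow> 'a::{real_normed_field,banach}" where
  "geometric_mgf q f n z = integral {0..1} (\<lambda>x. exp (z * of_real (\<Sum>k=1..n. f (real (q ^ k) * x))))"

locale lipschitz_periodic =
  fixes f :: "real \<Rightarrow> real" and C :: real
  assumes lip: "C-lipschitz_on UNIV f" and per: "\<And>x. f (x + 1) = f x"
begin

lemma C_nonneg: "0 \<le> C"
  using lip by (simp add: lipschitz_on_def)

lemma lipschitz_abs: "\<bar>f x - f y\<bar> \<le> C * \<bar>x - y\<bar>"
  using lipschitz_onD[OF lip, of x y] by (simp add: dist_real_def)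

lemma continuous_f: "continuous_on A f"
  using lipschitz_on_continuous_on[OF lip] by (rule continuous_on_subset) auto

lemma f_frac: "f (frac x) = f x"
proof (cases "0 \<le> \<lfloor>x\<rfloor>")
  case True
  hence "x = frac x + real (nat \<lfloor>x\<rfloor>)"
    by (simp add: frac_def)
  thus ?thesis
    using periodic_add_nat[of f "frac x" "nat \<lfloor>x\<rfloor>", OF per] by simp
next
  case False
  hence "frac x = x + real (nat (- \<lfloor>x\<rfloor>))"
    by (simp add: frac_def)
  thus ?thesis
    using periodic_add_nat[of f x "nat (- \<lfloor>x\<rfloor>)", OF per] by simp
qed

lemma range_f: "range f = f ` {0..1}"
proof -
  have "f x \<in> f ` {0..1}" for x
    using f_frac[of x] frac_ge_0[of x] frac_lt_1[of x] by (intro image_eqI[of _ _ "frac x"]) auto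
  thus ?thesis
    by auto
qed

lemma bounded_f:
  obtains K where "0 < K" "\<And>x. \<bar>f x\<bar> \<le> K"
proof -
  have "bounded (range f)"
    unfolding range_f by (intro compact_imp_bounded compact_continuous_image continuous_f) auto
  thus ?thesis
    using that unfolding bounded_pos by auto
qed

lemma geometric_mgf_eq_density:
  fixes z :: "'a::{real_normed_field,banach,euclidean_space}"
  assumes "0 < q"
  shows "geometric_mgf q f n z = integral {0..1} (branch_density q (\<lambda>x. exp (z * of_real (f x))) n)"
proof -
  have "geometric_mgf q f n z = integral {0..1} (\<lambda>x. \<Prod>k=1..n. exp (z * of_real (f (real (q ^ k) * x))))"
    unfolding geometric_mgf_def of_real_sum sum_distrib_left by (subst exp_sum) auto
  also have "\<dots> = integral {0..1} (branch_density q (\<lambda>x. exp (z * of_real (f x))) n)"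
    by (rule integral_prod_geometric) (auto intro!: continuous_intros continuous_f simp: per assms)
  finally show ?thesis .
qed

lemma log_lipschitz_exp: "log_lipschitz (\<bar>\<theta>\<bar> * C) (\<lambda>x. exp (\<theta> * f x))"
  unfolding log_lipschitz_def
proof (intro ballI conjI)
  fix x y :: real
  have "\<theta> * f x - \<theta> * f y \<le> \<bar>\<theta>\<bar> * \<bar>f x - f y\<bar>"
    by (metis abs_ge_self abs_mult right_diff_distrib)
  also have "\<dots> \<le> \<bar>\<theta>\<bar> * (C * \<bar>x - y\<bar>)"
    by (intro mult_left_mono lipschitz_abs) auto
  finally have "exp (\<theta> * f x) \<le> exp (\<bar>\<theta>\<bar> * C * \<bar>x - y\<bar> + \<theta> * f y)"
    by (simp add: algebra_simps)
  thus "exp (\<theta> * f x) \<le> exp (\<bar>\<theta>\<bar> * C * \<bar>x - y\<bar>) * exp (\<theta> * f y)"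
    by (simp add: exp_add)
qed simp

lemma continuous_exp_f: "continuous_on UNIV (\<lambda>x. exp (\<theta> * f x))"
  by (intro continuous_intros continuous_f)

lemma geometric_mgf_pos:
  assumes q: "2 \<le> q"
  shows "0 < geometric_mgf q f n (\<theta>::real)"
  using integral_branch_density_pos[OF log_lipschitz_exp[of \<theta>] _ continuous_exp_f q] q C_nonneg
  by (simp add: geometric_mgf_eq_density)

lemma geometric_mgf_of_real:
  "geometric_mgf q f n (complex_of_real \<theta>) = complex_of_real (geometric_mgf q f n \<theta>)"
proof -
  let ?h = "\<lambda>x. exp (\<theta> * (\<Sum>k=1..n. f (real (q ^ k) * x)))"
  have "continuous_on {0..1} ?h"
    by (intro continuous_intros continuous_on_compose2[OF continuous_f[of UNIV]]) auto
  hence "(?h has_integral integral {0..1} ?h) {0..1}"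
    using integrable_continuous_interval integrable_integral by blast
  from has_integral_linear[OF this bounded_linear_of_real[where 'a = complex]]
  have "((\<lambda>x. complex_of_real (?h x)) has_integral complex_of_real (integral {0..1} ?h)) {0..1}"
    by (simp add: o_def)
  hence "integral {0..1} (\<lambda>x. complex_of_real (?h x)) = complex_of_real (integral {0..1} ?h)"
    by (rule integral_unique)
  thus ?thesis
    unfolding geometric_mgf_def
    by (simp only: of_real_eq_id id_apply exp_of_real of_real_mult[symmetric])
qed

lemma quasi_additive_ln_mgf:
  assumes q: "2 \<le> q"
  shows "\<bar>ln (geometric_mgf q f (n + m) \<theta>) - ln (geometric_mgf q f n \<theta>) - ln (geometric_mgf q f m \<theta>)\<bar>
    \<le> 2 * (\<bar>\<theta>\<bar> * C) / real q"
  using quasi_additive_ln_density[OF log_lipschitz_exp[of \<theta>] _ continuous_exp_f _ q, of n m] q C_nonneg per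
  by (simp add: geometric_mgf_eq_density)

lemma geometric_mgf_Suc_ratio:
  assumes q: "2 \<le> q" and K: "\<And>x. \<bar>f x\<bar> \<le> K"
  shows "\<bar>ln (geometric_mgf q f (Suc n) \<theta> / geometric_mgf q f n \<theta>)\<bar> \<le> \<bar>\<theta>\<bar> * K"
proof -
  let ?w = "\<lambda>x. exp (\<theta> * f x)"
  let ?h = "branch_density q ?w n"
  have h: "0 \<le> ?h x" if "x \<in> {0..1}" for x
    using log_lipschitzD(1)[OF log_lipschitz_branch_density[OF log_lipschitz_exp _ q] that that, of \<theta> n] C_nonneg
    by simp
  have w: "exp (- (\<bar>\<theta>\<bar> * K)) \<le> ?w x" "?w x \<le> exp (\<bar>\<theta>\<bar> * K)" for x
  proof -
    have "\<bar>\<theta> * f x\<bar> \<le> \<bar>\<theta>\<bar> * K"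
      unfolding abs_mult by (intro mult_left_mono K) auto
    thus "exp (- (\<bar>\<theta>\<bar> * K)) \<le> ?w x" "?w x \<le> exp (\<bar>\<theta>\<bar> * K)"
      by auto
  qed
  have cont: "continuous_on A ?h" "continuous_on A ?w" for A
    by (intro continuous_intros continuous_f)+
  have eq: "geometric_mgf q f n \<theta> = integral {0..1} ?h"
    using q by (simp add: geometric_mgf_eq_density)
  have "geometric_mgf q f (Suc n) \<theta> = integral {0..1} (branch_mean q (\<lambda>x. ?w x * ?h x))"
    using q by (simp add: geometric_mgf_eq_density)
  also have "\<dots> = integral {0..1} (\<lambda>x. ?w x * ?h x)"
    using q by (intro integral_branch_mean continuous_intros cont) auto
  finally have eq': "geometric_mgf q f (Suc n) \<theta> = integral {0..1} (\<lambda>x. ?w x * ?h x)" .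
  have int: "(\<lambda>x. ?w x * ?h x) integrable_on {0..1}" "(\<lambda>x. c * ?h x) integrable_on {0..1}" for c
    by (intro integrable_continuous_interval continuous_intros cont)+
  have "integral {0..1} (\<lambda>x. exp (- (\<bar>\<theta>\<bar> * K)) * ?h x) \<le> geometric_mgf q f (Suc n) \<theta>"
    unfolding eq' using w h by (intro integral_le int mult_right_mono)
  hence lo: "exp (- (\<bar>\<theta>\<bar> * K)) \<le> geometric_mgf q f (Suc n) \<theta> / geometric_mgf q f n \<theta>"
    using geometric_mgf_pos[OF q, of n \<theta>] by (simp add: eq[symmetric] pos_le_divide_eq)
  have "geometric_mgf q f (Suc n) \<theta> \<le> integral {0..1} (\<lambda>x. exp (\<bar>\<theta>\<bar> * K) * ?h x)"
    unfolding eq' using w h by (intro integral_le int mult_right_mono)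
  hence up: "geometric_mgf q f (Suc n) \<theta> / geometric_mgf q f n \<theta> \<le> exp (\<bar>\<theta>\<bar> * K)"
    using geometric_mgf_pos[OF q, of n \<theta>] by (simp add: eq[symmetric] pos_divide_le_eq)
  show ?thesis
    using ln_ge_iff[of "geometric_mgf q f (Suc n) \<theta> / geometric_mgf q f n \<theta>" "- (\<bar>\<theta>\<bar> * K)"]
      ln_le_cancel_iff[of "geometric_mgf q f (Suc n) \<theta> / geometric_mgf q f n \<theta>" "exp (\<bar>\<theta>\<bar> * K)"]
      lo up geometric_mgf_pos[OF q] by (simp add: abs_le_iff)
qed

text \<open>Writing \<open>z = \<theta> + s\<close>, the complex weight \<open>exp (z f)\<close> is the positive weight \<open>exp (\<theta> f)\<close> times
  \<open>E = exp (s f)\<close>.  As \<open>f\<close> is bounded and Lipschitz continuous, \<open>E\<close> is an admissible perturbation when \<open>s\<close>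
  is small, uniformly in \<open>n\<close>.\<close>

lemma mgf_ratio_near_real:
  assumes q: "2 \<le> q"
  obtains \<delta> where "0 < \<delta>" "\<delta> \<le> 1"
    "\<And>z n. norm (z - complex_of_real \<theta>) < \<delta> \<Longrightarrow> geometric_mgf q f n z \<noteq> 0 \<and>
      norm (geometric_mgf q f (Suc n) z / geometric_mgf q f n z
        / of_real (geometric_mgf q f (Suc n) \<theta> / geometric_mgf q f n \<theta>) - 1) < 1 / 2"
proof -
  obtain K where K: "0 < K" "\<And>x. \<bar>f x\<bar> \<le> K"
    using bounded_f by blast
  define b where "b = \<bar>\<theta>\<bar> * C"
  define B where "B = 2 * b + 1"
  define \<eta> where "\<eta> = exp (- (5/2 * B)) / 24"
  \<comment> \<open>with this choice the supremum norm and the Lipschitz constant of \<open>E - 1\<close>, the latter with respect to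
    the contracted modulus, are at most \<open>\<eta>\<^sup>2\<close>\<close>
  define \<delta> where "\<delta> = \<eta>\<^sup>2 / (3 * (C + K + 1) * exp (3 * B))"
  have b: "0 \<le> b"
    using C_nonneg by (simp add: b_def)
  have B: "1 \<le> B"
    using b by (simp add: B_def)
  have "1 \<le> exp (3 * B)"
    using B by simp
  hence eB: "1 \<le> 3 * exp (3 * B)" "3 / 2 \<le> 3 * exp (3 * B)"
    by linarith+
  have \<eta>: "0 < \<eta>" "\<eta> \<le> 1 / 24"
    using B by (simp_all add: \<eta>_def)
  have CK: "1 \<le> C + K + 1"
    using K C_nonneg by simp
  have \<delta>: "0 < \<delta>"
    unfolding \<delta>_def using \<eta> CK by (intro divide_pos_pos mult_pos_pos) auto
  have eqd: "\<delta> * (C + K + 1) * (3 * exp (3 * B)) = \<eta>\<^sup>2"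
  proof -
    have aux: "a / (3 * x * y) * x * (3 * y) = a" if "x \<noteq> 0" "y \<noteq> 0" for a x y :: real
      using that by (simp add: field_simps)
    show ?thesis
      unfolding \<delta>_def by (rule aux) (use CK in auto)
  qed
  have "\<eta>\<^sup>2 \<le> (1 / 24)\<^sup>2"
    using \<eta> by (intro power_mono) auto
  moreover have "\<delta> * (C + K + 1) * 1 \<le> \<delta> * (C + K + 1) * (3 * exp (3 * B))"
    using \<delta> CK by (intro mult_left_mono eB) auto
  ultimately have \<delta>CK: "\<delta> * (C + K + 1) \<le> 1 / 2"
    unfolding eqd by (simp add: power2_eq_square)
  have "\<delta> * 1 \<le> \<delta> * (C + K + 1)"
    using CK \<delta> by (intro mult_left_mono) auto
  hence \<delta>1: "\<delta> \<le> 1"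
    using \<delta>CK by simp
  show ?thesis
  proof (rule that[OF \<delta> \<delta>1])
    fix z :: complex and n
    assume z: "norm (z - complex_of_real \<theta>) < \<delta>"
    define s where "s = z - complex_of_real \<theta>"
    define E where "E x = exp (s * of_real (f x))" for x
    have sCK: "norm s * C \<le> \<delta> * (C + K + 1)" "norm s * K \<le> \<delta> * (C + K + 1)"
      using z K C_nonneg \<delta> by (auto simp: s_def intro!: mult_mono)
    have sCK3: "norm s * C * (3 * exp (3 * B)) \<le> \<eta>\<^sup>2" "norm s * K * (3 * exp (3 * B)) \<le> \<eta>\<^sup>2"
      unfolding eqd[symmetric] using sCK by (auto intro!: mult_right_mono)
    have E1: "norm (E x - 1) \<le> 3 / 2 * (norm s * K)" for x
    proof -
      have "norm (s * of_real (f x)) \<le> norm s * K"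
        by (simp add: norm_mult mult_left_mono K)
      moreover from this have "norm (exp (s * of_real (f x)) - 1) \<le> 3 / 2 * norm (s * of_real (f x))"
        using sCK \<delta>CK by (intro norm_exp_bounds(2)) auto
      ultimately show ?thesis
        unfolding E_def by linarith
    qed
    have E2: "norm (E x - 1) \<le> \<eta>\<^sup>2" for x
    proof -
      have "3 / 2 * (norm s * K) \<le> (3 * exp (3 * B)) * (norm s * K)"
        using K by (intro mult_right_mono eB) auto
      thus ?thesis
        using E1[of x] sCK3(2) by (simp add: mult.commute)
    qed
    have E3: "norm (E x - E y) \<le> \<eta>\<^sup>2 * (1 - exp (- (3 * B * \<bar>x - y\<bar>)))"
      if xy: "x \<in> {0..1}" "y \<in> {0..1}" for x y
    proof -
      define t where "t = \<bar>x - y\<bar>"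
      have t: "0 \<le> t" "t \<le> 1"
        using xy by (auto simp: t_def)
      have d: "norm (s * of_real (f x - f y)) \<le> norm s * C * t"
        using mult_left_mono[OF lipschitz_abs[of x y], of "norm s"]
        by (simp only: norm_mult norm_of_real t_def) (simp add: mult.assoc)
      also have "\<dots> \<le> norm s * C * 1"
        using t C_nonneg by (intro mult_left_mono) auto
      finally have "norm (s * of_real (f x - f y)) \<le> 1 / 2"
        using sCK \<delta>CK by simp
      hence e: "norm (exp (s * of_real (f x - f y)) - 1) \<le> 3 / 2 * norm (s * of_real (f x - f y))"
        by (intro norm_exp_bounds(2)) auto
      have "norm (E y) \<le> 1 + norm (E y - 1)"
        using norm_triangle_sub[of "E y" 1] by simp
      hence Ey: "norm (E y) \<le> 2"
        using E1[of y] sCK \<delta>CK by linarith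
      have "E x = E y * exp (s * of_real (f x - f y))"
        by (simp add: E_def right_diff_distrib flip: exp_add)
      hence "E x - E y = E y * (exp (s * of_real (f x - f y)) - 1)"
        by (simp add: algebra_simps)
      hence "norm (E x - E y) = norm (E y) * norm (exp (s * of_real (f x - f y)) - 1)"
        by (simp only: norm_mult)
      also have "\<dots> \<le> 2 * (3 / 2 * (norm s * C * t))"
        using Ey e d by (intro mult_mono) auto
      finally have "norm (E x - E y) \<le> 3 * (norm s * C) * t"
        by (simp add: ac_simps)
      \<comment> \<open>the modulus of the contraction dominates a multiple of the distance\<close>
      also have "t \<le> exp (3 * B) * (1 - exp (- (3 * B * t)))"
      proof -
        have "3 * B * t + 1 \<le> exp (3 * B * t)"
          by (subst add.commute) (rule exp_ge_add_one_self)
        moreover have "t * 1 \<le> t * B"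
          using t B by (intro mult_left_mono) auto
        ultimately have "t \<le> exp (3 * B * t) - 1"
          using t by (simp add: mult.commute mult.left_commute)
        also have "\<dots> = exp (3 * B * t) * (1 - exp (- (3 * B * t)))"
          by (simp add: algebra_simps flip: exp_add)
        also have "\<dots> \<le> exp (3 * B) * (1 - exp (- (3 * B * t)))"
          using t B by (intro mult_right_mono) (auto simp: mult_left_le)
        finally show ?thesis .
      qed
      also have "3 * (norm s * C) * (exp (3 * B) * (1 - exp (- (3 * B * t))))
          = (norm s * C * (3 * exp (3 * B))) * (1 - exp (- (3 * B * t)))"
        by simp
      also have "\<dots> \<le> \<eta>\<^sup>2 * (1 - exp (- (3 * B * t)))"
        using sCK3 t B by (intro mult_right_mono) auto
      finally show ?thesis
        using C_nonneg by (simp add: t_def mult_left_mono)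
    qed
    have contE: "continuous_on UNIV E"
      unfolding E_def by (intro continuous_intros continuous_f)
    have wE: "(\<lambda>x. of_real (exp (\<theta> * f x)) * E x) = (\<lambda>x. exp (z * of_real (f x)))"
      by (simp add: E_def s_def left_diff_distrib exp_diff exp_of_real[symmetric])
    note ratio = perturbed_partition_ratio[OF log_lipschitz_exp[of \<theta>, folded b_def] continuous_exp_f b q contE,
        folded B_def, folded \<eta>_def, unfolded wE]
    have "integral {0..1} (branch_density q (\<lambda>x. exp (z * of_real (f x))) n) \<noteq> 0"
      by (rule ratio(1); use E2 E3 in blast)
    moreover have "norm (integral {0..1} (branch_density q (\<lambda>x. exp (z * of_real (f x))) (Suc n))
        / integral {0..1} (branch_density q (\<lambda>x. exp (z * of_real (f x))) n)
        / of_real (integral {0..1} (branch_density q (\<lambda>x. exp (\<theta> * f x)) (Suc n))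
          / integral {0..1} (branch_density q (\<lambda>x. exp (\<theta> * f x)) n)) - 1) < 1 / 2"
      by (rule ratio(2); use E2 E3 in blast)
    ultimately show "geometric_mgf q f n z \<noteq> 0 \<and>
      norm (geometric_mgf q f (Suc n) z / geometric_mgf q f n z
        / of_real (geometric_mgf q f (Suc n) \<theta> / geometric_mgf q f n \<theta>) - 1) < 1 / 2"
      using q by (simp only: geometric_mgf_eq_density of_real_eq_id id_apply simp_thms)
  qed
qed

end

section \<open>Vitali's theorem\<close>

text \<open>By Montel's theorem every subsequence has a locally uniformly convergent subsequence; all limits agree
  on \<open>S\<close>, hence on \<open>D\<close> by analytic continuation.\<close>

lemma Vitali_convergence:
  fixes F :: "nat \<Rightarrow> complex \<Rightarrow> complex"
  assumes D: "open D" "connected D" and hol: "\<And>n. F n holomorphic_on D"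
    and bounded: "\<And>K. compact K \<Longrightarrow> K \<subseteq> D \<Longrightarrow> \<exists>B. \<forall>n. \<forall>z\<in>K. norm (F n z) \<le> B"
    and S: "S \<subseteq> D" "\<xi> \<in> D" "\<xi> islimpt S" and conv: "\<And>z. z \<in> S \<Longrightarrow> convergent (\<lambda>n. F n z)"
  obtains g where "g holomorphic_on D"
    "\<And>K. compact K \<Longrightarrow> K \<subseteq> D \<Longrightarrow> uniform_limit K F g sequentially"
proof -
  have subseq: "\<exists>g r. g holomorphic_on D \<and> strict_mono (r :: nat \<Rightarrow> nat)
      \<and> (\<forall>z\<in>S. g z = lim (\<lambda>n. F n z))
      \<and> (\<forall>K. compact K \<and> K \<subseteq> D \<longrightarrow> uniform_limit K (\<lambda>n. F (s (r n))) g sequentially)"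
    if s: "strict_mono s" for s :: "nat \<Rightarrow> nat"
  proof -
    obtain g r where g: "g holomorphic_on D" "strict_mono (r :: nat \<Rightarrow> nat)"
      "\<And>z. z \<in> D \<Longrightarrow> ((\<lambda>n. F (s (r n)) z) \<longlongrightarrow> g z) sequentially"
      "\<And>K. compact K \<Longrightarrow> K \<subseteq> D \<Longrightarrow> uniform_limit K ((\<lambda>n. F (s n)) \<circ> r) g sequentially"
      by (rule Montel[of D "range F" "\<lambda>n. F (s n)"]) (use D hol bounded in auto)
    have "g z = lim (\<lambda>n. F n z)" if z: "z \<in> S" for z
    proof -
      have "(\<lambda>n. F n z) \<longlonglongrightarrow> lim (\<lambda>n. F n z)"
        using conv[OF z] by (simp add: convergent_LIMSEQ_iff)
      from LIMSEQ_subseq_LIMSEQ[OF this strict_mono_o[OF s g(2)]]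
      have "(\<lambda>n. F (s (r n)) z) \<longlonglongrightarrow> lim (\<lambda>n. F n z)"
        by (simp add: o_def)
      thus ?thesis
        using g(3) z S(1) LIMSEQ_unique by blast
    qed
    thus ?thesis
      using g by (intro exI[of _ g] exI[of _ r]) (auto simp: o_def)
  qed
  obtain g r where g: "g holomorphic_on D" "\<And>z. z \<in> S \<Longrightarrow> g z = lim (\<lambda>n. F n z)"
    using subseq[OF strict_mono_id] by auto
  show ?thesis
  proof (rule that[OF g(1)])
    fix K
    assume K: "compact K" "K \<subseteq> D"
    show "uniform_limit K F g sequentially"
    proof (rule ccontr)
      assume "\<not> ?thesis"
      then obtain e where e: "0 < e" "\<exists>\<^sub>F n in sequentially. \<exists>z\<in>K. e \<le> dist (F n z) (g z)"
        unfolding uniform_limit_iff not_eventually by (auto simp: not_eventually not_less)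
      hence "infinite {n. \<exists>z\<in>K. e \<le> dist (F n z) (g z)}"
        by (simp add: frequently_cofinite flip: cofinite_eq_sequentially)
      from infinite_enumerate[OF this] obtain s :: "nat \<Rightarrow> nat" where s: "strict_mono s"
        and far: "\<And>n. \<exists>z\<in>K. e \<le> dist (F (s n) z) (g z)"
        by auto
      obtain g' r where g': "g' holomorphic_on D" "\<And>z. z \<in> S \<Longrightarrow> g' z = lim (\<lambda>n. F n z)"
        "uniform_limit K (\<lambda>n. F (s (r n))) g' sequentially"
        using subseq[OF s] K by blast
      have "g' z - g z = 0" if "z \<in> D" for z
        by (rule analytic_continuation[of "\<lambda>z. g' z - g z" D S \<xi>])
           (use D S g g' that in \<open>auto intro!: holomorphic_intros\<close>)
      hence eq: "g' z = g z" if "z \<in> K" for z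
        using K(2) that by auto
      have "\<forall>\<^sub>F n in sequentially. \<forall>z\<in>K. dist (F (s (r n)) z) (g z) < e"
        by (rule eventually_mono[OF uniform_limitD[OF g'(3) e(1)]]) (simp add: eq)
      then obtain n where "\<forall>z\<in>K. dist (F (s (r n)) z) (g z) < e"
        unfolding eventually_sequentially by blast
      thus False
        using far[of "r n"] by force
    qed
  qed
qed

section \<open>The complex logarithmic moment generating function\<close>

context lipschitz_periodic
begin

lemma holomorphic_geometric_mgf: "geometric_mgf q f n holomorphic_on UNIV"
proof -
  define s where "s x = (\<Sum>k=1..n. f (real (q ^ k) * x))" for x
  have s: "continuous_on A s" for A
    unfolding s_def by (intro continuous_intros continuous_on_compose2[OF continuous_f[of UNIV]]) auto
  have "(\<lambda>z. integral (cbox 0 1) (\<lambda>x. exp (z * complex_of_real (s x)))) holomorphic_on UNIV"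
  proof (rule leibniz_rule_holomorphic)
    show "((\<lambda>z. exp (z * complex_of_real (s t))) has_field_derivative
        of_real (s t) * exp (z * of_real (s t))) (at z within UNIV)" for z t
      by (auto intro!: derivative_eq_intros)
    show "(\<lambda>x. exp (z * complex_of_real (s x))) integrable_on cbox 0 1" for z
      by (intro integrable_continuous continuous_intros s)
    show "continuous_on (UNIV \<times> cbox 0 1) (\<lambda>(z, t). of_real (s t) * exp (z * complex_of_real (s t)))"
      unfolding case_prod_unfold by (intro continuous_intros continuous_on_compose2[OF s]) auto
  qed simp
  thus ?thesis
    by (simp add: geometric_mgf_def[abs_def] s_def)
qed

text \<open>Consecutive quotients of the moment generating functions stay in the right half plane on a union of
  discs centred at the real points.  Hence their principal logarithms are holomorphic there, although the
  one of the moment generating function itself need not be.\<close>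

lemma mgf_log_domain:
  assumes q: "2 \<le> q" and K: "0 < K" "\<And>x. \<bar>f x\<bar> \<le> K"
  obtains D where "open D" "connected D" "range complex_of_real \<subseteq> D"
    "\<And>z n. z \<in> D \<Longrightarrow> geometric_mgf q f n z \<noteq> 0"
    "\<And>z n. z \<in> D \<Longrightarrow> 0 < Re (geometric_mgf q f (Suc n) z / geometric_mgf q f n z)"
    "\<And>z n. z \<in> D \<Longrightarrow>
      norm (Ln (geometric_mgf q f (Suc n) z / geometric_mgf q f n z)) \<le> (norm z + 1) * K + 1"
proof -
  have "\<exists>\<delta>. 0 < \<delta> \<and> \<delta> \<le> 1 \<and> (\<forall>z n. norm (z - complex_of_real \<theta>) < \<delta> \<longrightarrow> geometric_mgf q f n z \<noteq> 0 \<and>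
      norm (geometric_mgf q f (Suc n) z / geometric_mgf q f n z
        / of_real (geometric_mgf q f (Suc n) \<theta> / geometric_mgf q f n \<theta>) - 1) < 1 / 2)" for \<theta>
    by (rule mgf_ratio_near_real[OF q, of \<theta>]) blast
  then obtain \<delta> where \<delta>: "\<And>\<theta>. 0 < \<delta> \<theta>" "\<And>\<theta>. \<delta> \<theta> \<le> 1"
    "\<And>\<theta> z n. norm (z - complex_of_real \<theta>) < \<delta> \<theta> \<Longrightarrow> geometric_mgf q f n z \<noteq> 0"
    "\<And>\<theta> z n. norm (z - complex_of_real \<theta>) < \<delta> \<theta> \<Longrightarrow>
      norm (geometric_mgf q f (Suc n) z / geometric_mgf q f n z
        / of_real (geometric_mgf q f (Suc n) \<theta> / geometric_mgf q f n \<theta>) - 1) < 1 / 2"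
    by metis
  define D where "D = (\<Union>\<theta>. ball (complex_of_real \<theta>) (\<delta> \<theta>))"
  have D: "\<exists>\<theta>. norm (z - complex_of_real \<theta>) < \<delta> \<theta>" if "z \<in> D" for z
    using that by (auto simp: D_def dist_norm norm_minus_commute)
  have real_D: "range complex_of_real \<subseteq> D"
    using \<delta>(1) by (auto simp: D_def intro: centre_in_ball[THEN iffD2])
  have "connected (\<Union>\<theta>. range complex_of_real \<union> ball (complex_of_real \<theta>) (\<delta> \<theta>))"
  proof (rule connected_Union)
    fix A
    assume "A \<in> range (\<lambda>\<theta>. range complex_of_real \<union> ball (complex_of_real \<theta>) (\<delta> \<theta>))"
    then obtain \<theta> where A: "A = range complex_of_real \<union> ball (complex_of_real \<theta>) (\<delta> \<theta>)"
      by blast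
    have "complex_of_real \<theta> \<in> range complex_of_real \<inter> ball (complex_of_real \<theta>) (\<delta> \<theta>)"
      using \<delta>(1) by simp
    hence ne: "range complex_of_real \<inter> ball (complex_of_real \<theta>) (\<delta> \<theta>) \<noteq> {}"
      by blast
    have "connected (range complex_of_real)"
      by (intro connected_continuous_image continuous_intros connected_UNIV)
    thus "connected A"
      unfolding A by (rule connected_Un[OF _ connected_ball ne])
  qed auto
  also have "(\<Union>\<theta>. range complex_of_real \<union> ball (complex_of_real \<theta>) (\<delta> \<theta>)) = D"
    using real_D by (auto simp: D_def)
  finally have conn: "connected D" .
  show ?thesis
  proof (rule that[OF _ conn real_D])
    show "open D"
      by (auto simp: D_def)
    fix z n
    assume "z \<in> D"
    then obtain \<theta> where \<theta>: "norm (z - complex_of_real \<theta>) < \<delta> \<theta>"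
      using D by blast
    show "geometric_mgf q f n z \<noteq> 0"
      by (rule \<delta>(3)[OF \<theta>])
    define r where "r = geometric_mgf q f (Suc n) \<theta> / geometric_mgf q f n \<theta>"
    define R where "R = geometric_mgf q f (Suc n) z / geometric_mgf q f n z"
    define c where "c = R / of_real r"
    have r: "0 < r"
      using geometric_mgf_pos[OF q] by (simp add: r_def)
    have c: "norm (c - 1) < 1 / 2"
      using \<delta>(4)[OF \<theta>, of n] by (simp add: c_def R_def r_def)
    have R: "R = of_real r * c"
      using r by (simp add: c_def)
    have "\<bar>Re c - 1\<bar> < 1 / 2"
      using order_le_less_trans[OF abs_Re_le_cmod[of "c - 1"] c] by simp
    hence Rec: "0 < Re c"
      by linarith
    show "0 < Re (geometric_mgf q f (Suc n) z / geometric_mgf q f n z)"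
      unfolding R_def[symmetric] using R r Rec by simp
    have "c \<noteq> 0"
      using Rec by auto
    hence "Ln R = of_real (ln r) + Ln c"
      using r by (simp add: R Ln_times_of_real Ln_of_real)
    hence "norm (Ln R) \<le> \<bar>ln r\<bar> + norm (Ln c)"
      by (metis norm_of_real norm_triangle_ineq)
    also have "\<dots> \<le> \<bar>\<theta>\<bar> * K + 1"
    proof (rule add_mono)
      show "\<bar>ln r\<bar> \<le> \<bar>\<theta>\<bar> * K"
        unfolding r_def by (rule geometric_mgf_Suc_ratio[OF q K(2)])
      show "norm (Ln c) \<le> 1"
        using norm_Ln_le[of "c - 1"] c by simp
    qed
    also have "\<bar>\<theta>\<bar> \<le> norm z + 1"
      using norm_triangle_sub[of "complex_of_real \<theta>" z] \<theta> \<delta>(2)[of \<theta>] by (simp add: norm_minus_commute)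
    finally show "norm (Ln (geometric_mgf q f (Suc n) z / geometric_mgf q f n z)) \<le> (norm z + 1) * K + 1"
      using K(1) by (simp add: R_def mult_right_mono)
  qed
qed

text \<open>The required branch is \<open>L n = (\<Sum>k<n. Ln (Z (k + 1) / Z k))\<close>.  The bound on the summands makes \<open>L n / n\<close>
  locally bounded, and on the real axis it converges by assumption, so that Vitali's theorem applies.\<close>

lemma complex_log_mgf:
  assumes q: "2 \<le> q" and lim: "\<And>\<theta>. (\<lambda>n. ln (geometric_mgf q f n \<theta>) / real n) \<longlonglongrightarrow> \<Lambda> \<theta>"
  obtains D L g where "open D" "range complex_of_real \<subseteq> D"
    "\<And>n. L n holomorphic_on D"
    "\<And>n z. z \<in> D \<Longrightarrow> exp (L n z) = geometric_mgf q f n z"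
    "\<And>n \<theta>. L n (complex_of_real \<theta>) = complex_of_real (ln (geometric_mgf q f n \<theta>))"
    "g holomorphic_on D" "\<And>\<theta>. g (complex_of_real \<theta>) = complex_of_real (\<Lambda> \<theta>)"
    "\<And>K. compact K \<Longrightarrow> K \<subseteq> D \<Longrightarrow> uniform_limit K (\<lambda>n z. L n z / of_nat n) g sequentially"
proof -
  obtain B where B: "0 < B" "\<And>x. \<bar>f x\<bar> \<le> B"
    using bounded_f by blast
  obtain D where D: "open D" "connected D" "range complex_of_real \<subseteq> D"
    and nz: "\<And>z n. z \<in> D \<Longrightarrow> geometric_mgf q f n z \<noteq> 0"
    and Re_pos: "\<And>z n. z \<in> D \<Longrightarrow> 0 < Re (geometric_mgf q f (Suc n) z / geometric_mgf q f n z)"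
    and bound: "\<And>z n. z \<in> D \<Longrightarrow>
      norm (Ln (geometric_mgf q f (Suc n) z / geometric_mgf q f n z)) \<le> (norm z + 1) * B + 1"
    by (rule mgf_log_domain[OF q B]) blast
  define L where "L n z = (\<Sum>k<n. Ln (geometric_mgf q f (Suc k) z / geometric_mgf q f k z))" for n z
  have mgf_0: "geometric_mgf q f 0 z = 1" for z :: "'b::{real_normed_field,banach}"
    by (simp add: geometric_mgf_def)
  have hol_mgf: "geometric_mgf q f n holomorphic_on D" for n
    using holomorphic_geometric_mgf by (rule holomorphic_on_subset) simp
  have L_hol: "L n holomorphic_on D" for n
    unfolding L_def
  proof (intro holomorphic_intros hol_mgf)
    show "geometric_mgf q f (Suc k) z / geometric_mgf q f k z \<notin> \<real>\<^sub>\<le>\<^sub>0" if "z \<in> D" for z k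
      using Re_pos[OF that, of k] by (auto simp: complex_nonpos_Reals_iff)
  qed (use nz in auto)
  have L_exp: "exp (L n z) = geometric_mgf q f n z" if "z \<in> D" for n z
  proof (induction n)
    case (Suc n)
    have "exp (L (Suc n) z) = exp (L n z) * exp (Ln (geometric_mgf q f (Suc n) z / geometric_mgf q f n z))"
      by (simp add: L_def exp_add)
    thus ?case
      using nz[OF that] Suc by simp
  qed (simp add: L_def mgf_0)
  have L_real: "L n (complex_of_real \<theta>) = complex_of_real (ln (geometric_mgf q f n \<theta>))" for n \<theta>
  proof (induction n)
    case (Suc n)
    note pos = geometric_mgf_pos[OF q, of _ \<theta>]
    have "L (Suc n) (of_real \<theta>) = L n (of_real \<theta>)
        + Ln (of_real (geometric_mgf q f (Suc n) \<theta> / geometric_mgf q f n \<theta>))"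
      by (simp add: L_def geometric_mgf_of_real)
    also have "Ln (of_real (geometric_mgf q f (Suc n) \<theta> / geometric_mgf q f n \<theta>))
        = of_real (ln (geometric_mgf q f (Suc n) \<theta> / geometric_mgf q f n \<theta>))"
      using pos by (intro Ln_of_real) simp
    also have "ln (geometric_mgf q f (Suc n) \<theta> / geometric_mgf q f n \<theta>)
        = ln (geometric_mgf q f (Suc n) \<theta>) - ln (geometric_mgf q f n \<theta>)"
      using pos[of n] pos[of "Suc n"] by (simp add: ln_div)
    finally show ?case
      using Suc by simp
  qed (simp add: L_def mgf_0)
  have L_bound: "norm (L n z / of_nat n) \<le> (norm z + 1) * B + 1" if "z \<in> D" for n z
  proof (cases "n = 0")
    case False
    have "norm (L n z) \<le> (\<Sum>k<n. (norm z + 1) * B + 1)"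
      unfolding L_def using bound[OF that] by (rule sum_norm_le)
    thus ?thesis
      using False by (simp add: norm_divide divide_le_eq mult.commute)
  qed (use B in \<open>simp add: L_def\<close>)
  obtain g where g: "g holomorphic_on D"
    "\<And>K. compact K \<Longrightarrow> K \<subseteq> D \<Longrightarrow> uniform_limit K (\<lambda>n z. L n z / of_nat n) g sequentially"
  proof (rule Vitali_convergence[of D "\<lambda>n z. L n z / of_nat n" "range complex_of_real" 0])
    show "(\<lambda>z. L n z / of_nat n) holomorphic_on D" for n
      using L_hol[of n] by (cases "n = 0") (auto intro!: holomorphic_intros)
    show "\<exists>B. \<forall>n. \<forall>z\<in>K. norm (L n z / of_nat n) \<le> B" if K: "compact K" "K \<subseteq> D" for K
    proof -
      obtain b where b: "\<And>z. z \<in> K \<Longrightarrow> norm z \<le> b"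
        using compact_imp_bounded[OF K(1)] by (auto simp: bounded_iff)
      have "norm (L n z / of_nat n) \<le> (b + 1) * B + 1" if z: "z \<in> K" for n z
      proof -
        have "norm (L n z / of_nat n) \<le> (norm z + 1) * B + 1"
          using L_bound z K(2) by blast
        also have "\<dots> \<le> (b + 1) * B + 1"
          using b[OF z] B(1) by (simp add: mult_right_mono)
        finally show ?thesis .
      qed
      thus ?thesis
        by blast
    qed
    show "(0::complex) islimpt range complex_of_real"
      unfolding islimpt_approachable
    proof (intro allI impI)
      fix e :: real
      assume "0 < e"
      thus "\<exists>x'\<in>range complex_of_real. x' \<noteq> 0 \<and> dist x' 0 < e"
        by (intro bexI[OF _ rangeI[of complex_of_real "e / 2"]]) (simp add: norm_divide)
    qed
    show "(0::complex) \<in> D"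
      using D(3) by (metis of_real_0 range_subsetD)
    show "convergent (\<lambda>n. L n z / of_nat n)" if "z \<in> range complex_of_real" for z
    proof -
      obtain \<theta> where \<theta>: "z = complex_of_real \<theta>"
        using \<open>z \<in> range complex_of_real\<close> by blast
      have "(\<lambda>n. complex_of_real (ln (geometric_mgf q f n \<theta>) / real n)) \<longlonglongrightarrow> complex_of_real (\<Lambda> \<theta>)"
        by (intro tendsto_of_real lim)
      thus ?thesis
        unfolding convergent_def \<theta> by (auto simp: L_real)
    qed
  qed (use D in auto)
  have g_real: "g (complex_of_real \<theta>) = complex_of_real (\<Lambda> \<theta>)" for \<theta>
  proof -
    have "uniform_limit {complex_of_real \<theta>} (\<lambda>n z. L n z / of_nat n) g sequentially"
      using D(3) by (intro g(2)) auto
    hence "(\<lambda>n. L n (complex_of_real \<theta>) / of_nat n) \<longlonglongrightarrow> g (complex_of_real \<theta>)"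
      by (rule tendsto_uniform_limitI) simp
    moreover have "(\<lambda>n. complex_of_real (ln (geometric_mgf q f n \<theta>) / real n)) \<longlonglongrightarrow> complex_of_real (\<Lambda> \<theta>)"
      by (intro tendsto_of_real lim)
    ultimately show ?thesis
      by (simp add: L_real LIMSEQ_unique)
  qed
  show ?thesis
    by (rule that[OF D(1,3) L_hol L_exp L_real g(1) g_real g(2)])
qed

text \<open>\<open>\<Lambda>\<close> is the restriction to the real axis of a holomorphic function.\<close>

lemma differentiable_log_mgf_limit:
  assumes q: "2 \<le> q" and lim: "\<And>\<theta>. (\<lambda>n. ln (geometric_mgf q f n \<theta>) / real n) \<longlonglongrightarrow> \<Lambda> \<theta>"
  shows "\<Lambda> differentiable (at \<theta>)"
proof -
  obtain D g where D: "open D" "range complex_of_real \<subseteq> D" and g: "g holomorphic_on D"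
    and g_real: "\<And>\<theta>. g (complex_of_real \<theta>) = complex_of_real (\<Lambda> \<theta>)"
    by (rule complex_log_mgf[of q \<Lambda>, OF q lim]) blast
  have "complex_of_real \<theta> \<in> D"
    using D(2) by blast
  from holomorphic_derivI[OF g D(1) this]
  have "(g has_field_derivative deriv g (of_real \<theta>)) (at (complex_of_real \<theta>))" .
  hence "((\<lambda>x. g (complex_of_real x)) has_vector_derivative deriv g (of_real \<theta>)) (at \<theta>)"
    by (rule has_vector_derivative_real_field)
  hence "((\<lambda>x. Re (g (complex_of_real x))) has_vector_derivative Re (deriv g (of_real \<theta>))) (at \<theta>)"
    by (rule bounded_linear.has_vector_derivative[OF bounded_linear_Re])
  hence "(\<Lambda> has_real_derivative Re (deriv g (of_real \<theta>))) (at \<theta>)"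
    by (simp add: g_real has_real_derivative_iff_has_vector_derivative)
  thus ?thesis
    by (auto simp: real_differentiable_def)
qed

end

section \<open>Rate functions\<close>

lemma legendre_fenchel_ge: "ereal (\<theta> * x - \<Lambda> \<theta>) \<le> legendre_fenchel \<Lambda> x"
  unfolding legendre_fenchel_def by (rule SUP_upper) simp

lemma legendre_fenchel_nonneg:
  assumes "\<Lambda> 0 = 0"
  shows "0 \<le> legendre_fenchel \<Lambda> x"
  using legendre_fenchel_ge[of 0 x \<Lambda>] assms by (simp add: zero_ereal_def)

lemma lower_semicontinuous_legendre_fenchel: "lower_semicontinuous (legendre_fenchel \<Lambda>)"
  unfolding lower_semicontinuous_def le_Liminf_iff
proof (intro allI impI)
  fix x y
  assume "y < legendre_fenchel \<Lambda> x"
  then obtain \<theta> where \<theta>: "y < ereal (\<theta> * x - \<Lambda> \<theta>)"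
    unfolding legendre_fenchel_def less_SUP_iff by auto
  have "((\<lambda>u. ereal (\<theta> * u - \<Lambda> \<theta>)) \<longlongrightarrow> ereal (\<theta> * x - \<Lambda> \<theta>)) (at x)"
    by (intro tendsto_intros)
  from order_tendstoD(1)[OF this \<theta>]
  show "\<forall>\<^sub>F u in at x. y < legendre_fenchel \<Lambda> u"
    by eventually_elim (use legendre_fenchel_ge order_less_le_trans in blast)
qed

text \<open>Each \<open>\<theta>\<close> imposes a closed linear constraint on a sublevel set; those of \<open>\<theta> = 1\<close> and
  \<open>\<theta> = - 1\<close> bound it.\<close>

lemma good_rate_function_legendre_fenchel: "good_rate_function (legendre_fenchel \<Lambda>)"
  unfolding good_rate_function_def
proof (intro allI impI)
  fix c :: real
  let ?L = "{x. legendre_fenchel \<Lambda> x \<le> ereal c}"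
  have "?L = (\<Inter>\<theta>. {x. \<theta> * x - \<Lambda> \<theta> \<le> c})"
    by (auto simp: legendre_fenchel_def SUP_le_iff)
  hence "closed ?L"
    by (auto intro!: closed_INT closed_Collect_le continuous_intros)
  moreover have "?L \<subseteq> {- (c + \<Lambda> (- 1))..c + \<Lambda> 1}"
  proof
    fix x
    assume "x \<in> ?L"
    hence le: "legendre_fenchel \<Lambda> x \<le> ereal c"
      by simp
    have "ereal (1 * x - \<Lambda> 1) \<le> ereal c" "ereal (- 1 * x - \<Lambda> (- 1)) \<le> ereal c"
      by (rule order_trans[OF legendre_fenchel_ge le])+
    thus "x \<in> {- (c + \<Lambda> (- 1))..c + \<Lambda> 1}"
      by auto
  qed
  ultimately show "compact ?L"
    by (meson bounded_closed_interval bounded_subset compact_eq_bounded_closed)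
qed

section \<open>The Gaertner--Ellis theorem for bounded sequences\<close>

lemma elog_div_le:
  assumes "0 < n" "0 \<le> p" "p \<le> exp (- a * n)"
  shows "elog p / ereal n \<le> ereal (- a)"
proof (cases "p = 0")
  case False
  hence "ln p \<le> - a * n"
    using assms ln_le_cancel_iff[of p "exp (- a * n)"] by simp
  thus ?thesis
    using False assms by (simp add: elog_def pos_divide_le_eq)
qed (use assms in \<open>simp add: elog_def\<close>)

lemma elog_div_ge:
  assumes "0 < n" "exp (b * n) \<le> p"
  shows "ereal b \<le> elog p / ereal n"
proof -
  have p: "0 < p"
    using assms(2) exp_gt_zero order_less_le_trans by blast
  hence "b * n \<le> ln p"
    using assms(2) by (simp add: ln_ge_iff)
  thus ?thesis
    using p assms by (simp add: elog_def pos_le_divide_eq)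
qed

text \<open>The uniform bound on \<open>S n / n\<close> makes all exponential moments finite and reduces the upper bound for
  closed sets to compact ones.\<close>

locale mgf_limit = prob_space M for M :: "'a measure" +
  fixes S :: "nat \<Rightarrow> 'a \<Rightarrow> real" and K :: real and \<Lambda> :: "real \<Rightarrow> real"
  assumes meas [measurable]: "\<And>n. S n \<in> borel_measurable M"
    and bdd: "\<And>n \<omega>. \<omega> \<in> space M \<Longrightarrow> \<bar>S n \<omega>\<bar> \<le> K * real n"
    and lim: "\<And>\<theta>. (\<lambda>n. ln (\<integral>\<omega>. exp (\<theta> * S n \<omega>) \<partial>M) / real n) \<longlonglongrightarrow> \<Lambda> \<theta>"
begin

definition mgf :: "nat \<Rightarrow> real \<Rightarrow> real" where
  "mgf n \<theta> = (\<integral>\<omega>. exp (\<theta> * S n \<omega>) \<partial>M)"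

definition pr :: "nat \<Rightarrow> real set \<Rightarrow> real" where
  "pr n A = prob {\<omega> \<in> space M. S n \<omega> / real n \<in> A}"

lemma exponent_bounds:
  assumes "\<omega> \<in> space M"
  shows "\<theta> * S n \<omega> \<le> \<bar>\<theta>\<bar> * (K * real n)" "- (\<bar>\<theta>\<bar> * (K * real n)) \<le> \<theta> * S n \<omega>"
proof -
  have "\<bar>\<theta> * S n \<omega>\<bar> \<le> \<bar>\<theta>\<bar> * (K * real n)"
    unfolding abs_mult by (intro mult_left_mono bdd assms) auto
  thus "\<theta> * S n \<omega> \<le> \<bar>\<theta>\<bar> * (K * real n)" "- (\<bar>\<theta>\<bar> * (K * real n)) \<le> \<theta> * S n \<omega>"
    by auto
qed

lemma integrable_exp: "integrable M (\<lambda>\<omega>. exp (\<theta> * S n \<omega>))"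
proof (rule integrable_const_bound[where B = "exp (\<bar>\<theta>\<bar> * (K * real n))"])
  show "AE \<omega> in M. norm (exp (\<theta> * S n \<omega>)) \<le> exp (\<bar>\<theta>\<bar> * (K * real n))"
    using exponent_bounds(1)[of _ \<theta> n] by (intro AE_I2) auto
qed measurable

lemma mgf_pos: "0 < mgf n \<theta>"
proof -
  have "exp (- (\<bar>\<theta>\<bar> * (K * real n))) \<le> mgf n \<theta>"
    unfolding mgf_def
    using exponent_bounds(2)[of _ \<theta> n] by (intro integral_ge_const integrable_exp AE_I2) auto
  thus ?thesis
    using exp_gt_zero order_less_le_trans by blast
qed

lemma mgf_0: "mgf n 0 = 1"
  by (simp add: mgf_def prob_space)

lemma Lambda_0: "\<Lambda> 0 = 0"
  using lim[of 0] by (simp add: prob_space LIMSEQ_const_iff)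

lemma eventually_mgf_le:
  assumes "\<Lambda> \<theta> < a"
  shows "\<forall>\<^sub>F n in sequentially. mgf n \<theta> \<le> exp (a * real n)"
  using order_tendstoD(2)[OF lim assms] eventually_gt_at_top[of 0]
proof eventually_elim
  case (elim n)
  hence "ln (mgf n \<theta>) \<le> a * real n"
    by (simp add: mgf_def pos_divide_less_eq)
  thus ?case
    using mgf_pos[of n \<theta>] ln_le_cancel_iff[of "mgf n \<theta>" "exp (a * real n)"] by simp
qed

lemma eventually_mgf_ge:
  assumes "a < \<Lambda> \<theta>"
  shows "\<forall>\<^sub>F n in sequentially. exp (a * real n) \<le> mgf n \<theta>"
  using order_tendstoD(1)[OF lim assms] eventually_gt_at_top[of 0]
proof eventually_elim
  case (elim n)
  hence "a * real n \<le> ln (mgf n \<theta>)"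
    by (simp add: mgf_def pos_less_divide_eq)
  thus ?case
    using mgf_pos[of n \<theta>] by (simp add: ln_ge_iff)
qed

lemma exp_decay_le:
  assumes "0 < c" "0 < e"
  shows "\<forall>\<^sub>F n in sequentially. exp (- c * real n) \<le> e"
proof -
  have "(\<lambda>n. exp (- c * real n)) \<longlonglongrightarrow> 0"
    using assms(1) by real_asymp
  from order_tendstoD(2)[OF this assms(2)] show ?thesis
    by eventually_elim simp
qed

text \<open>The form in which the exponential rates are used below: a term of strictly smaller rate is
  eventually dominated.\<close>

lemma eventually_mgf_negligible:
  assumes "\<Lambda> \<eta> + d < \<Lambda> \<theta>"
  shows "\<forall>\<^sub>F n in sequentially. exp (d * real n) * mgf n \<eta> \<le> mgf n \<theta> / 4"
proof -
  define c where "c = (\<Lambda> \<theta> - d - \<Lambda> \<eta>) / 3"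
  have c: "0 < c"
    using assms by (simp add: c_def)
  have "\<forall>\<^sub>F n in sequentially. mgf n \<eta> \<le> exp ((\<Lambda> \<eta> + c) * real n)"
    using c by (intro eventually_mgf_le) simp
  moreover have "\<forall>\<^sub>F n in sequentially. exp ((\<Lambda> \<theta> - c) * real n) \<le> mgf n \<theta>"
    using c by (intro eventually_mgf_ge) simp
  moreover have "\<forall>\<^sub>F n in sequentially. exp (- c * real n) \<le> 1 / 4"
    using c by (intro exp_decay_le) auto
  ultimately show ?thesis
  proof eventually_elim
    case (elim n)
    have "exp (d * real n) * mgf n \<eta> \<le> exp (d * real n) * exp ((\<Lambda> \<eta> + c) * real n)"
      using elim(1) by (intro mult_left_mono) auto
    also have "\<dots> = exp (- c * real n) * exp ((\<Lambda> \<theta> - c) * real n)"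
    proof -
      have "d * real n + (\<Lambda> \<eta> + c) * real n = (d + \<Lambda> \<eta> + c) * real n"
        by (simp add: algebra_simps)
      also have "d + \<Lambda> \<eta> + c = - c + (\<Lambda> \<theta> - c)"
        by (simp add: c_def field_simps)
      finally show ?thesis
        by (simp add: algebra_simps flip: exp_add)
    qed
    also have "\<dots> \<le> 1 / 4 * mgf n \<theta>"
      using elim by (intro mult_mono) auto
    finally show ?case
      by simp
  qed
qed

lemma integral_indicator_pr:
  assumes [measurable]: "A \<in> sets borel"
  shows "(\<integral>\<omega>. indicator A (S n \<omega> / real n) \<partial>M) = pr n A"
    and "integrable M (\<lambda>\<omega>. indicator A (S n \<omega> / real n) :: real)"
proof -
  let ?E = "{\<omega> \<in> space M. S n \<omega> / real n \<in> A}"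
  have E [measurable]: "?E \<in> sets M"
    by measurable
  have "(\<integral>\<omega>. indicator A (S n \<omega> / real n) \<partial>M) = (\<integral>\<omega>. indicator ?E \<omega> \<partial>M)"
    by (intro Bochner_Integration.integral_cong) (auto simp: indicator_def)
  also have "\<dots> = pr n A"
    using E sets.sets_into_space[OF E] by (simp add: pr_def Int_absorb2)
  finally show "(\<integral>\<omega>. indicator A (S n \<omega> / real n) \<partial>M) = pr n A" .
  show "integrable M (\<lambda>\<omega>. indicator A (S n \<omega> / real n) :: real)"
    by (rule integrable_const_bound[where B = 1]) (auto simp: indicator_def)
qed

text \<open>Exponential Markov inequality.\<close>

lemma chernoff:
  assumes A: "A \<in> sets borel" and c: "\<And>y. y \<in> A \<Longrightarrow> c \<le> \<theta> * y" and n: "0 < n"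
  shows "pr n A \<le> exp (- c * real n) * mgf n \<theta>"
proof -
  have "(\<integral>\<omega>. indicator A (S n \<omega> / real n) \<partial>M) \<le> (\<integral>\<omega>. exp (- c * real n) * exp (\<theta> * S n \<omega>) \<partial>M)"
  proof (intro integral_mono integral_indicator_pr A integrable_mult_right integrable_exp)
    fix \<omega>
    show "indicator A (S n \<omega> / real n) \<le> exp (- c * real n) * exp (\<theta> * S n \<omega>)"
    proof (cases "S n \<omega> / real n \<in> A")
      case True
      hence "c * real n \<le> \<theta> * S n \<omega>"
        using c[of "S n \<omega> / real n"] n by (simp add: field_simps)
      thus ?thesis
        using True by (simp flip: exp_add)
    qed auto
  qed
  thus ?thesis
    using integral_indicator_pr[OF A] by (simp add: mgf_def)
qed

text \<open>Each point \<open>x\<close> of the closure has a tilt \<open>\<theta>\<close> with \<open>\<theta> x - \<Lambda> \<theta> > a\<close>; the Chernoff bound gives the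
  rate \<open>a\<close> on a half line containing \<open>x\<close>, and finitely many of these half lines cover the compact part of
  the closure that matters.\<close>

lemma upper_bound_eventually:
  assumes A: "A \<in> sets borel" and a: "ereal a < (INF x\<in>closure A. legendre_fenchel \<Lambda> x)"
  shows "\<forall>\<^sub>F n in sequentially. pr n A \<le> exp (- a * real n)"
proof -
  let ?C = "closure A \<inter> {- K..K}"
  have "\<exists>\<theta> c. a < c \<and> c < \<theta> * x - \<Lambda> \<theta>" if x: "x \<in> ?C" for x
  proof -
    have "ereal a < legendre_fenchel \<Lambda> x"
      using a x by (meson IntD1 INF_lower order_less_le_trans)
    then obtain \<theta> where "a < \<theta> * x - \<Lambda> \<theta>"
      unfolding legendre_fenchel_def less_SUP_iff by auto
    thus ?thesis
      using dense by blast
  qed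
  then obtain \<theta> c where \<theta>: "\<And>x. x \<in> ?C \<Longrightarrow> a < c x \<and> c x < \<theta> x * x - \<Lambda> (\<theta> x)"
    by metis
  define U where "U x = {y. c x + \<Lambda> (\<theta> x) < \<theta> x * y}" for x
  have U: "open (U x)" for x
    unfolding U_def by (intro open_Collect_less continuous_intros)
  have small: "(\<lambda>n. pr n (U x) * exp (a * real n)) \<longlonglongrightarrow> 0" if x: "x \<in> ?C" for x
  proof -
    define d where "d = (c x - a) / 2"
    have d: "0 < d"
      using \<theta>[OF x] by (simp add: d_def)
    have h:  "(\<lambda>n. exp (- d * real n)) \<longlonglongrightarrow> 0"
      using d by real_asymp
    have lo: "\<forall>\<^sub>F n in sequentially. 0 \<le> pr n (U x) * exp (a * real n)"
      by (simp add: pr_def)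
    have "\<forall>\<^sub>F n in sequentially. mgf n (\<theta> x) \<le> exp ((\<Lambda> (\<theta> x) + d) * real n)"
      using d by (intro eventually_mgf_le) simp
    hence up: "\<forall>\<^sub>F n in sequentially. pr n (U x) * exp (a * real n) \<le> exp (- d * real n)"
      using eventually_gt_at_top[of 0]
    proof eventually_elim
      case (elim n)
      have "pr n (U x) \<le> exp (- (c x + \<Lambda> (\<theta> x)) * real n) * mgf n (\<theta> x)"
        using elim U by (intro chernoff) (auto simp: U_def)
      also have "\<dots> \<le> exp (- (c x + \<Lambda> (\<theta> x)) * real n) * exp ((\<Lambda> (\<theta> x) + d) * real n)"
        using elim by (intro mult_left_mono) auto
      finally have "pr n (U x) * exp (a * real n)
          \<le> exp (- (c x + \<Lambda> (\<theta> x)) * real n) * exp ((\<Lambda> (\<theta> x) + d) * real n) * exp (a * real n)"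
        by (rule mult_right_mono) simp
      also have "\<dots> = exp ((- (c x + \<Lambda> (\<theta> x)) + (\<Lambda> (\<theta> x) + d) + a) * real n)"
        by (simp only: distrib_right exp_add)
      also have "- (c x + \<Lambda> (\<theta> x)) + (\<Lambda> (\<theta> x) + d) + a = - d"
        by (simp add: d_def field_simps)
      finally show ?case .
    qed
    show ?thesis
      by (rule tendsto_sandwich[OF lo up tendsto_const h])
  qed
  have "compact ?C"
    by (intro closed_Int_compact) auto
  moreover have "?C \<subseteq> (\<Union>x\<in>?C. U x)"
  proof
    fix x
    assume x: "x \<in> ?C"
    hence "x \<in> U x"
      using \<theta>[OF x] by (simp add: U_def)
    with x show "x \<in> (\<Union>x\<in>?C. U x)"
      by blast
  qed
  ultimately obtain T where T: "T \<subseteq> ?C" "finite T" "?C \<subseteq> (\<Union>x\<in>T. U x)"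
    using compactE_image[of ?C ?C U, OF _ U] by blast
  have cover: "pr n A \<le> (\<Sum>x\<in>T. pr n (U x))" if n: "0 < n" for n
  proof -
    have "S n \<omega> / real n \<in> {- K..K}" if "\<omega> \<in> space M" for \<omega>
      using bdd[OF that, of n] n by (auto simp: abs_le_iff field_simps)
    hence incl: "{\<omega> \<in> space M. S n \<omega> / real n \<in> A} \<subseteq> (\<Union>x\<in>T. {\<omega> \<in> space M. S n \<omega> / real n \<in> U x})"
      using T(3) closure_subset[of A] by blast
    have meas_U: "{\<omega> \<in> space M. S n \<omega> / real n \<in> U x} \<in> sets M" for x
    proof -
      have [measurable]: "U x \<in> sets borel"
        using U by (rule borel_open)
      show ?thesis
        by measurable
    qed
    have "(\<Union>x\<in>T. {\<omega> \<in> space M. S n \<omega> / real n \<in> U x}) \<in> sets M"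
      using T(2) meas_U by blast
    from finite_measure_mono[OF incl this]
    have "pr n A \<le> prob (\<Union>x\<in>T. {\<omega> \<in> space M. S n \<omega> / real n \<in> U x})"
      by (simp only: pr_def)
    also have "\<dots> \<le> (\<Sum>x\<in>T. pr n (U x))"
      unfolding pr_def by (rule finite_measure_subadditive_finite[OF T(2)]) (use meas_U in blast)
    finally show ?thesis .
  qed
  have "(\<lambda>n. \<Sum>x\<in>T. pr n (U x) * exp (a * real n)) \<longlonglongrightarrow> (\<Sum>x\<in>T. 0)"
    by (intro tendsto_sum small) (use T in blast)
  hence "\<forall>\<^sub>F n in sequentially. (\<Sum>x\<in>T. pr n (U x) * exp (a * real n)) < 1"
    by (intro order_tendstoD) auto
  thus ?thesis
    using eventually_gt_at_top[of 0]
  proof eventually_elim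
    case (elim n)
    have "pr n A * exp (a * real n) \<le> (\<Sum>x\<in>T. pr n (U x)) * exp (a * real n)"
      using cover elim by (intro mult_right_mono) auto
    hence "pr n A * exp (a * real n) \<le> 1"
      using elim by (simp add: sum_distrib_right)
    thus ?case
      by (simp add: exp_minus field_simps)
  qed
qed

text \<open>Under the measure with density proportional to \<open>exp (\<theta> S n)\<close> the quotient \<open>S n / n\<close> concentrates at
  \<open>y = \<Lambda>' \<theta>\<close>: tilting further by a small \<open>\<plusminus>s\<close> bounds its mass outside \<open>(y - r, y + r)\<close>, because there
  \<open>\<Lambda> (\<theta> \<plusminus> s) - \<Lambda> \<theta>\<close> is smaller than what the Chernoff bound gains.  Inside the interval the density
  varies only by a factor \<open>exp (n \<bar>\<theta>\<bar> r)\<close>.\<close>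

lemma tilted_lower_bound:
  assumes deriv: "(\<Lambda> has_real_derivative y) (at \<theta>)" and r: "0 < r"
    and b: "b < \<Lambda> \<theta> - \<theta> * y - \<bar>\<theta>\<bar> * r"
  shows "\<forall>\<^sub>F n in sequentially. exp (b * real n) \<le> pr n {y - r<..<y + r}"
proof -
  let ?I = "{y - r<..<y + r}"
  obtain \<delta> where \<delta>: "0 < \<delta>" "\<And>h. h \<noteq> 0 \<Longrightarrow> \<bar>h\<bar> < \<delta> \<Longrightarrow> \<bar>(\<Lambda> (\<theta> + h) - \<Lambda> \<theta>) / h - y\<bar> < r"
    using LIM_D[OF DERIV_D[OF deriv] r] by auto
  define s where "s = \<delta> / 2"
  have s: "0 < s" "s < \<delta>"
    using \<delta>(1) by (auto simp: s_def)
  have right: "\<Lambda> (\<theta> + s) + (- s * (y + r)) < \<Lambda> \<theta>"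
  proof -
    have "(\<Lambda> (\<theta> + s) - \<Lambda> \<theta>) / s < y + r"
      using \<delta>(2)[of s] s by (simp add: abs_less_iff)
    thus ?thesis
      using s by (simp add: pos_divide_less_eq algebra_simps)
  qed
  have left: "\<Lambda> (\<theta> - s) + s * (y - r) < \<Lambda> \<theta>"
  proof -
    have "(\<Lambda> (\<theta> - s) - \<Lambda> \<theta>) / s < r - y"
      using \<delta>(2)[of "- s"] s by (simp add: abs_less_iff)
    hence "\<Lambda> (\<theta> - s) - \<Lambda> \<theta> < (r - y) * s"
      by (subst (asm) pos_divide_less_eq[OF s(1)])
    thus ?thesis
      by (simp add: algebra_simps)
  qed
  have main: "\<Lambda> 0 + (b + (\<theta> * y + \<bar>\<theta>\<bar> * r)) < \<Lambda> \<theta>"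
    using b Lambda_0 by simp
  show ?thesis
    using eventually_mgf_negligible[OF right] eventually_mgf_negligible[OF left]
      eventually_mgf_negligible[OF main] eventually_gt_at_top[of 0]
  proof eventually_elim
    case (elim n)
    let ?e = "exp ((\<theta> * y + \<bar>\<theta>\<bar> * r) * real n)"
    have "mgf n \<theta> \<le> (\<integral>\<omega>. ?e * indicator ?I (S n \<omega> / real n)
        + exp (- s * (y + r) * real n) * exp ((\<theta> + s) * S n \<omega>)
        + exp (s * (y - r) * real n) * exp ((\<theta> - s) * S n \<omega>) \<partial>M)"
      unfolding mgf_def
    proof (intro integral_mono Bochner_Integration.integrable_add integrable_mult_right integrable_exp
        integral_indicator_pr)
      fix \<omega>
      let ?S = "S n \<omega>"
      consider "y + r \<le> ?S / real n" | "?S / real n \<le> y - r" | "?S / real n \<in> ?I"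
        by (metis greaterThanLessThan_iff not_le)
      thus "exp (\<theta> * ?S) \<le> ?e * indicator ?I (?S / real n)
        + exp (- s * (y + r) * real n) * exp ((\<theta> + s) * ?S)
        + exp (s * (y - r) * real n) * exp ((\<theta> - s) * ?S)"
      proof cases
        case 1
        hence "(y + r) * real n \<le> ?S"
          using elim(4) by (simp add: pos_le_divide_eq)
        hence "s * ((y + r) * real n) \<le> s * ?S"
          using s by (intro mult_left_mono) auto
        hence "exp (\<theta> * ?S) \<le> exp (- s * (y + r) * real n) * exp ((\<theta> + s) * ?S)"
          by (simp add: algebra_simps flip: exp_add)
        thus ?thesis
          by (simp add: add_increasing add_increasing2)
      next
        case 2
        hence "?S \<le> (y - r) * real n"
          using elim(4) by (simp add: pos_divide_le_eq)
        hence "s * ?S \<le> s * ((y - r) * real n)"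
          using s by (intro mult_left_mono) auto
        hence "exp (\<theta> * ?S) \<le> exp (s * (y - r) * real n) * exp ((\<theta> - s) * ?S)"
          by (simp add: algebra_simps flip: exp_add)
        thus ?thesis
          by (simp add: add_increasing)
      next
        case 3
        hence "\<bar>?S / real n - y\<bar> \<le> r"
          by auto
        hence "\<theta> * (?S / real n - y) \<le> \<bar>\<theta>\<bar> * r"
          using abs_ge_self[of "\<theta> * (?S / real n - y)"] mult_left_mono[of "\<bar>?S / real n - y\<bar>" r "\<bar>\<theta>\<bar>"]
          unfolding abs_mult by linarith
        hence "\<theta> * (?S / real n) * real n \<le> (\<theta> * y + \<bar>\<theta>\<bar> * r) * real n"
          by (intro mult_right_mono) (auto simp: algebra_simps)
        hence "exp (\<theta> * ?S) \<le> ?e"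
          using elim(4) by simp
        thus ?thesis
          using 3 by (simp add: add_increasing2)
      qed
    qed auto
    also have "\<dots> = ?e * pr n ?I + exp (- s * (y + r) * real n) * mgf n (\<theta> + s)
        + exp (s * (y - r) * real n) * mgf n (\<theta> - s)"
      using integral_indicator_pr[of ?I n] integrable_exp by (simp add: mgf_def)
    finally have "mgf n \<theta> \<le> ?e * pr n ?I + mgf n \<theta> / 4 + mgf n \<theta> / 4"
      using elim(1,2) by (simp add: algebra_simps)
    hence "exp ((b + (\<theta> * y + \<bar>\<theta>\<bar> * r)) * real n) \<le> ?e * pr n ?I"
      using elim(3) mgf_pos[of n \<theta>] by (simp add: mgf_0)
    moreover have "(b + (\<theta> * y + \<bar>\<theta>\<bar> * r)) * real n = (\<theta> * y + \<bar>\<theta>\<bar> * r) * real n + b * real n"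
      by (simp add: algebra_simps)
    ultimately have "?e * exp (b * real n) \<le> ?e * pr n ?I"
      by (simp only: exp_add)
    thus ?case
      by simp
  qed
qed

text \<open>The point \<open>x\<close> need not be a derivative of \<open>\<Lambda>\<close>.  Maximising \<open>\<theta> x - \<Lambda> \<theta> - \<kappa> \<theta>\<^sup>2 / 2\<close>, where the quadratic
  penalty forces the maximum to be attained, yields \<open>\<theta>\<close> with \<open>\<Lambda>' \<theta> = x - \<kappa> \<theta>\<close>.  This derivative is close to
  \<open>x\<close> for small \<open>\<kappa>\<close>, and its cost does not exceed the value of the rate function at \<open>x\<close>.\<close>

lemma lower_bound_eventually:
  assumes diff: "\<And>\<theta>. \<Lambda> differentiable (at \<theta>)" and x: "x \<in> interior A" and A: "A \<in> sets borel"
    and b: "ereal b < - legendre_fenchel \<Lambda> x"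
  shows "\<forall>\<^sub>F n in sequentially. exp (b * real n) \<le> pr n A"
proof -
  define i where "i = real_of_ereal (legendre_fenchel \<Lambda> x)"
  have I: "legendre_fenchel \<Lambda> x = ereal i"
    using b legendre_fenchel_nonneg[of \<Lambda> x, OF Lambda_0]
    by (cases "legendre_fenchel \<Lambda> x") (auto simp: i_def)
  have i: "0 \<le> i"
    using legendre_fenchel_nonneg[of \<Lambda> x, OF Lambda_0] unfolding I by simp
  have sup: "\<theta> * x - \<Lambda> \<theta> \<le> i" for \<theta>
    using legendre_fenchel_ge[of \<theta> x \<Lambda>] unfolding I by simp
  have bi: "b < - i"
    using b unfolding I by simp
  obtain \<epsilon> where \<epsilon>: "0 < \<epsilon>" "ball x \<epsilon> \<subseteq> A"
    using x by (auto simp: mem_interior)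
  \<comment> \<open>small enough for \<open>\<kappa> \<bar>\<theta>\<bar> \<le> sqrt (2 \<kappa> i) \<le> \<epsilon> / 2\<close> at the maximiser\<close>
  define \<kappa> where "\<kappa> = \<epsilon>\<^sup>2 / (8 * (i + 1))"
  have \<kappa>: "0 < \<kappa>"
    using \<epsilon> i by (simp add: \<kappa>_def)
  define F where "F \<theta> = \<theta> * x - \<Lambda> \<theta> - \<kappa> * \<theta>\<^sup>2 / 2" for \<theta>
  have contF: "continuous_on T F" for T
  proof -
    have "continuous_on T \<Lambda>"
      by (intro continuous_at_imp_continuous_on ballI differentiable_imp_continuous_within diff)
    thus ?thesis
      unfolding F_def by (intro continuous_intros) auto
  qed
  \<comment> \<open>beyond \<open>R\<close> the penalty exceeds \<open>i\<close>, so that \<open>F\<close> is negative\<close>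
  define R where "R = 2 * i / \<kappa> + 1"
  have R: "1 \<le> R"
    using i \<kappa> by (simp add: R_def)
  obtain \<theta> where \<theta>R: "\<theta> \<in> {- R..R}" "\<And>u. u \<in> {- R..R} \<Longrightarrow> F u \<le> F \<theta>"
    using continuous_attains_sup[OF compact_Icc _ contF, of "- R" R] R by fastforce
  have F0: "0 \<le> F \<theta>"
    using \<theta>R(2)[of 0] R by (simp add: F_def Lambda_0)
  have max: "F u \<le> F \<theta>" for u
  proof (cases "u \<in> {- R..R}")
    case False
    hence "R * 1 \<le> \<bar>u\<bar> * \<bar>u\<bar>"
      using R by (intro mult_mono) auto
    hence "\<kappa> * R \<le> \<kappa> * u\<^sup>2"
      using \<kappa> by (intro mult_left_mono) (auto simp: power2_eq_square)
    moreover have "\<kappa> * R = 2 * i + \<kappa>"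
      using \<kappa> by (simp add: R_def field_simps)
    ultimately have "F u \<le> 0"
      using sup[of u] \<kappa> by (simp add: F_def)
    thus ?thesis
      using F0 by simp
  qed (rule \<theta>R)
  obtain y where y: "(\<Lambda> has_real_derivative y) (at \<theta>)"
    using diff[of \<theta>] by (auto simp: real_differentiable_def)
  have "(F has_real_derivative (x - y - \<kappa> * \<theta>)) (at \<theta>)"
    unfolding F_def by (rule derivative_eq_intros y refl | simp)+
  hence "x - y - \<kappa> * \<theta> = 0"
    by (rule DERIV_local_max[of _ _ _ 1]) (use max in auto)
  hence y_eq: "y = x - \<kappa> * \<theta>"
    by simp
  have "\<kappa> * \<theta>\<^sup>2 \<le> 2 * i"
    using F0 sup[of \<theta>] by (simp add: F_def)
  hence "(\<kappa> * \<bar>\<theta>\<bar>)\<^sup>2 \<le> \<kappa> * (2 * i)"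
    using \<kappa> by (simp add: power_mult_distrib power2_eq_square[of \<kappa>] mult_left_mono)
  also have "\<dots> \<le> (\<epsilon> / 2)\<^sup>2"
    using i by (simp add: \<kappa>_def field_simps power2_eq_square)
  finally have near: "\<kappa> * \<bar>\<theta>\<bar> \<le> \<epsilon> / 2"
    by (rule power2_le_imp_le) (use \<epsilon> in auto)
  define r where "r = min (\<epsilon> / 2) ((- i - b) / (2 * (\<bar>\<theta>\<bar> + 1)))"
  have r: "0 < r" "r \<le> \<epsilon> / 2" "r \<le> (- i - b) / (2 * (\<bar>\<theta>\<bar> + 1))"
  proof -
    show "0 < r"
      unfolding r_def min_less_iff_conj using \<epsilon> bi by (intro conjI divide_pos_pos) auto
  qed (auto simp only: r_def min.cobounded1 min.cobounded2)
  have "r * (2 * (\<bar>\<theta>\<bar> + 1)) \<le> - i - b"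
    using r(3) by (subst (asm) pos_le_divide_eq) auto
  moreover have "r * (2 * (\<bar>\<theta>\<bar> + 1)) = 2 * (\<bar>\<theta>\<bar> * r) + 2 * r" "0 \<le> \<bar>\<theta>\<bar> * r"
    using r by (simp_all add: algebra_simps)
  ultimately have "\<bar>\<theta>\<bar> * r < - i - b"
    using r(1) by linarith
  moreover have "\<theta> * y - \<Lambda> \<theta> \<le> i"
  proof -
    have "\<theta> * y - \<Lambda> \<theta> = (\<theta> * x - \<Lambda> \<theta>) - \<kappa> * \<theta>\<^sup>2"
      by (simp add: y_eq algebra_simps power2_eq_square)
    moreover have "0 \<le> \<kappa> * \<theta>\<^sup>2"
      using \<kappa> by simp
    ultimately show ?thesis
      using sup[of \<theta>] by linarith
  qed
  ultimately have "\<forall>\<^sub>F n in sequentially. exp (b * real n) \<le> pr n {y - r<..<y + r}"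
    by (intro tilted_lower_bound[OF y r(1)]) simp
  moreover have sub: "{y - r<..<y + r} \<subseteq> A"
  proof
    fix u
    assume "u \<in> {y - r<..<y + r}"
    hence "\<bar>u - y\<bar> < r"
      by auto
    moreover have "\<bar>y - x\<bar> = \<kappa> * \<bar>\<theta>\<bar>"
      using \<kappa> by (simp add: y_eq abs_mult)
    ultimately have "\<bar>x - u\<bar> < \<epsilon>"
      using near r by linarith
    thus "u \<in> A"
      using \<epsilon>(2) by (auto simp: dist_real_def)
  qed
  moreover have "pr n {y - r<..<y + r} \<le> pr n A" for n
    unfolding pr_def using sub A by (intro finite_measure_mono) auto
  ultimately show ?thesis
    by (auto elim!: eventually_mono intro: order_trans)
qed

theorem gaertner_ellis:
  assumes diff: "\<And>\<theta>. \<Lambda> differentiable (at \<theta>)"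
  shows "satisfies_LDP M (\<lambda>n \<omega>. S n \<omega> / real n) (\<lambda>n. real n) (legendre_fenchel \<Lambda>)"
  unfolding satisfies_LDP_def pr_def[symmetric]
proof (intro conjI allI ballI impI)
  show "filterlim (\<lambda>n. real n) at_top sequentially"
    by (rule filterlim_real_sequentially)
  show "lower_semicontinuous (legendre_fenchel \<Lambda>)"
    by (rule lower_semicontinuous_legendre_fenchel)
  show "0 \<le> legendre_fenchel \<Lambda> x" for x
    by (rule legendre_fenchel_nonneg[of \<Lambda> x, OF Lambda_0])
  fix A :: "real set"
  assume A: "A \<in> sets borel"
  let ?X = "\<lambda>n. elog (pr n A) / ereal (real n)"
  show "liminf ?X \<le> limsup ?X"
    by (rule Liminf_le_Limsup) simp
  show "limsup ?X \<le> - (INF x\<in>closure A. legendre_fenchel \<Lambda> x)"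
  proof (rule ccontr)
    assume "\<not> ?thesis"
    then obtain z where z: "- (INF x\<in>closure A. legendre_fenchel \<Lambda> x) < ereal z" "ereal z < limsup ?X"
      using ereal_dense2[of "- (INF x\<in>closure A. legendre_fenchel \<Lambda> x)" "limsup ?X"] by (auto simp: not_le)
    have "ereal (- z) < (INF x\<in>closure A. legendre_fenchel \<Lambda> x)"
      using z(1) by (simp add: ereal_uminus_less_reorder flip: uminus_ereal.simps)
    from upper_bound_eventually[OF A this] eventually_gt_at_top[of 0]
    have "\<forall>\<^sub>F n in sequentially. ?X n \<le> ereal z"
    proof eventually_elim
      case (elim n)
      thus ?case
        using elog_div_le[of "real n" "pr n A" "- z"] by (simp add: pr_def)
    qed
    hence "limsup ?X \<le> ereal z"
      by (rule Limsup_bounded)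
    thus False
      using z(2) by simp
  qed
  show "- (INF x\<in>interior A. legendre_fenchel \<Lambda> x) \<le> liminf ?X"
  proof (rule ccontr)
    assume "\<not> ?thesis"
    then obtain z where z: "liminf ?X < ereal z" "ereal z < - (INF x\<in>interior A. legendre_fenchel \<Lambda> x)"
      using ereal_dense2[of "liminf ?X" "- (INF x\<in>interior A. legendre_fenchel \<Lambda> x)"] by (auto simp: not_le)
    have "(INF x\<in>interior A. legendre_fenchel \<Lambda> x) < - ereal z"
      using z(2) by (metis ereal_less_uminus_reorder)
    then obtain x where x: "x \<in> interior A" "legendre_fenchel \<Lambda> x < - ereal z"
      unfolding INF_less_iff by blast
    have "ereal z < - legendre_fenchel \<Lambda> x"
      using x(2) by (metis ereal_less_uminus_reorder)
    from lower_bound_eventually[OF diff x(1) A this] eventually_gt_at_top[of 0]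
    have "\<forall>\<^sub>F n in sequentially. ereal z \<le> ?X n"
      by eventually_elim (intro elog_div_ge, auto)
    hence "ereal z \<le> liminf ?X"
      by (rule Liminf_bounded)
    thus False
      using z(1) by simp
  qed
qed (use meas in auto)

end

section \<open>Large frequency ratios\<close>

text \<open>Since the Legendre--Fenchel transform is nonnegative, only those \<open>\<theta>\<close> matter for which
  \<open>\<theta> x - \<Lambda> \<theta>\<close> is positive.\<close>

lemma legendre_fenchel_le_add:
  assumes "\<And>\<theta>. \<theta> * x - \<Lambda> \<theta> \<le> 0 \<or> \<Lambda>' \<theta> \<le> \<Lambda> \<theta> + \<epsilon>" and "\<Lambda>' 0 = 0" "0 \<le> \<epsilon>"
  shows "legendre_fenchel \<Lambda> x \<le> legendre_fenchel \<Lambda>' x + ereal \<epsilon>"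
  unfolding legendre_fenchel_def[of \<Lambda>]
proof (rule SUP_least)
  fix \<theta>
  consider "\<theta> * x - \<Lambda> \<theta> \<le> 0" | "\<theta> * x - \<Lambda> \<theta> \<le> (\<theta> * x - \<Lambda>' \<theta>) + \<epsilon>"
    using assms(1)[of \<theta>] by linarith
  thus "ereal (\<theta> * x - \<Lambda> \<theta>) \<le> legendre_fenchel \<Lambda>' x + ereal \<epsilon>"
  proof cases
    case 1
    hence "ereal (\<theta> * x - \<Lambda> \<theta>) \<le> 0 + ereal \<epsilon>"
      using assms(3) by simp
    also have "\<dots> \<le> legendre_fenchel \<Lambda>' x + ereal \<epsilon>"
      by (intro add_right_mono legendre_fenchel_nonneg assms)
    finally show ?thesis .
  next
    case 2
    hence "ereal (\<theta> * x - \<Lambda> \<theta>) \<le> ereal (\<theta> * x - \<Lambda>' \<theta>) + ereal \<epsilon>"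
      by simp
    also have "\<dots> \<le> legendre_fenchel \<Lambda>' x + ereal \<epsilon>"
      by (intro add_right_mono legendre_fenchel_ge)
    finally show ?thesis .
  qed
qed

lemma legendre_fenchel_eq_infinity:
  assumes "0 < \<delta>" and "\<And>t. 0 \<le> t \<Longrightarrow> \<delta> * t \<le> s * t * x - \<Lambda> (s * t)"
  shows "legendre_fenchel \<Lambda> x = \<infinity>"
proof (rule ereal_top)
  fix B :: real
  define t where "t = \<bar>B\<bar> / \<delta>"
  have "B \<le> \<delta> * t"
    using assms(1) by (simp add: t_def)
  also have "\<dots> \<le> s * t * x - \<Lambda> (s * t)"
    using assms(1) by (intro assms(2)) (simp add: t_def)
  finally have "ereal B \<le> ereal (s * t * x - \<Lambda> (s * t))"
    by simp
  also have "\<dots> \<le> legendre_fenchel \<Lambda> x"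
    by (rule legendre_fenchel_ge)
  finally show "ereal B \<le> legendre_fenchel \<Lambda> x" .
qed

context lipschitz_periodic
begin

lemma Lambda_indep_eq: "Lambda_indep f \<theta> = ln (integral {0..1} (\<lambda>x. exp (\<theta> * f x)))"
  unfolding Lambda_indep_def
  by (intro arg_cong[where f = ln] set_borel_integral_eq_integral borel_integrable_atLeastAtMost')
     (intro continuous_intros continuous_f)

lemma geometric_mgf_1:
  assumes "0 < q"
  shows "geometric_mgf q f (Suc 0) \<theta> = integral {0..1} (\<lambda>x. exp (\<theta> * f x))"
proof -
  have "geometric_mgf q f (Suc 0) \<theta> = integral {0..1} (branch_mean q (\<lambda>x. exp (\<theta> * f x)))"
    using geometric_mgf_eq_density[OF assms, of "Suc 0" \<theta>] by simp
  also have "\<dots> = integral {0..1} (\<lambda>x. exp (\<theta> * f x))"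
    by (intro integral_branch_mean continuous_exp_f assms)
  finally show ?thesis .
qed

text \<open>For every \<open>q\<close>, the first moment generating function is that of \<open>f\<close> at a uniform point, so the
  distance to \<open>Lambda_indep f\<close> is the distance of the limit to the first term of a quasi-additive sequence.\<close>

lemma log_mgf_limit:
  assumes q: "2 \<le> q"
  obtains l where "(\<lambda>n. ln (geometric_mgf q f n \<theta>) / real n) \<longlonglongrightarrow> l"
    "\<bar>l - Lambda_indep f \<theta>\<bar> \<le> 2 * (\<bar>\<theta>\<bar> * C) / real q"
proof -
  obtain l where l: "(\<lambda>n. ln (geometric_mgf q f n \<theta>) / real n) \<longlonglongrightarrow> l"
    "\<And>m. 1 \<le> m \<Longrightarrow> \<bar>l - ln (geometric_mgf q f m \<theta>) / real m\<bar> \<le> 2 * (\<bar>\<theta>\<bar> * C) / real q / real m"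
    by (rule quasi_additive_convergent[of "\<lambda>n. ln (geometric_mgf q f n \<theta>)", OF quasi_additive_ln_mgf[OF q]]) blast
  show ?thesis
    using that[OF l(1)] l(2)[of 1] q by (simp add: geometric_mgf_1 Lambda_indep_eq)
qed

text \<open>An interval of length \<open>r\<close> around a point where \<open>f\<close> takes the value \<open>f u\<close> contributes enough.\<close>

lemma Lambda_indep_ge:
  assumes r: "0 < r" "r \<le> 1 / 2"
  shows "\<theta> * f u - \<bar>\<theta>\<bar> * (C * r) + ln r \<le> Lambda_indep f \<theta>"
proof -
  obtain v where v: "v \<in> {0..1}" "f v = f u"
    using range_f by (metis imageE rangeI)
  define a where "a = (if v \<le> 1 / 2 then v else v - r)"
  have a: "0 \<le> a" "a + r \<le> 1" "a \<le> v" "v \<le> a + r"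
    using v r by (auto simp: a_def)
  have le: "exp (\<theta> * f u - \<bar>\<theta>\<bar> * (C * r)) \<le> exp (\<theta> * f x)" if x: "x \<in> {a..a + r}" for x
  proof -
    have "\<bar>f v - f x\<bar> \<le> C * \<bar>v - x\<bar>"
      by (rule lipschitz_abs)
    also have "\<dots> \<le> C * r"
      using x a C_nonneg by (intro mult_left_mono) auto
    finally have "\<bar>\<theta>\<bar> * \<bar>f v - f x\<bar> \<le> \<bar>\<theta>\<bar> * (C * r)"
      by (rule mult_left_mono) simp
    hence "\<theta> * (f v - f x) \<le> \<bar>\<theta>\<bar> * (C * r)"
      unfolding abs_mult[symmetric] by linarith
    thus ?thesis
      using v(2) by (simp add: algebra_simps)
  qed
  have int: "(\<lambda>x. exp (\<theta> * f x)) integrable_on T" if "T = {c..d}" for T and c d :: real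
    unfolding that by (intro integrable_continuous_interval continuous_intros continuous_f)
  have "exp (\<theta> * f u - \<bar>\<theta>\<bar> * (C * r)) * r = integral {a..a + r} (\<lambda>x. exp (\<theta> * f u - \<bar>\<theta>\<bar> * (C * r)))"
    using r by simp
  also have "\<dots> \<le> integral {a..a + r} (\<lambda>x. exp (\<theta> * f x))"
    using le by (intro integral_le int refl) auto
  also have "\<dots> \<le> integral {0..1} (\<lambda>x. exp (\<theta> * f x))"
    using a by (intro integral_subset_le int refl) auto
  finally have le': "exp (\<theta> * f u - \<bar>\<theta>\<bar> * (C * r)) * r \<le> integral {0..1} (\<lambda>x. exp (\<theta> * f x))" .
  have pos: "0 < exp (\<theta> * f u - \<bar>\<theta>\<bar> * (C * r)) * r"
    using r by simp
  from ln_mono[OF le' pos]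
  show ?thesis
    using r by (simp add: Lambda_indep_eq ln_mult)
qed

lemma Lambda_indep_le:
  assumes "\<And>u. \<theta> * f u \<le> c"
  shows "Lambda_indep f \<theta> \<le> c"
proof -
  have int: "(\<lambda>x. exp (\<theta> * f x)) integrable_on {0..1}"
    by (intro integrable_continuous_interval continuous_intros continuous_f)
  have "integral {0..1} (\<lambda>x. exp (\<theta> * f x)) \<le> integral {0..1} (\<lambda>x::real. exp c)"
    using assms by (intro integral_le int) auto
  hence le: "integral {0..1} (\<lambda>x. exp (\<theta> * f x)) \<le> exp c"
    by simp
  have "0 < integral {0..1} (\<lambda>x. exp (\<theta> * f x))"
    using geometric_mgf_pos[of 2 "Suc 0" \<theta>] by (simp add: geometric_mgf_1)
  thus ?thesis
    using le ln_le_cancel_iff[of "integral {0..1} (\<lambda>x. exp (\<theta> * f x))" "exp c"]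
    by (simp add: Lambda_indep_eq)
qed

text \<open>Evaluating the lower bound for \<open>Lambda_indep f\<close> at a value \<open>f u = x \<plusminus> \<delta> / 2\<close>, with the sign of
  \<open>\<theta>\<close>, shows that \<open>\<theta> x - Lambda_indep f \<theta>\<close> is negative for large \<open>\<bar>\<theta>\<bar>\<close>, by a margin that exceeds
  \<open>\<bar>\<theta>\<bar> d\<close>; for the remaining bounded range of \<open>\<theta>\<close> the two functions are \<open>\<epsilon>\<close>-close.\<close>

lemma rate_function_close_inside:
  assumes \<delta>: "0 < \<delta>" and ball: "ball x \<delta> \<subseteq> range f"
    and r: "0 < r" "r \<le> 1 / 2" "C * r \<le> \<delta> / 4"
    and near: "\<And>\<theta>. \<bar>\<Lambda> \<theta> - Lambda_indep f \<theta>\<bar> \<le> \<bar>\<theta>\<bar> * d" and d: "0 \<le> d" "d \<le> \<delta> / 8"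
    and \<epsilon>: "d * (8 * \<bar>ln r\<bar> / \<delta>) \<le> \<epsilon>" "0 \<le> \<epsilon>"
  shows "legendre_fenchel \<Lambda> x \<le> I_indep f x + ereal \<epsilon> \<and> I_indep f x \<le> legendre_fenchel \<Lambda> x + ereal \<epsilon>"
proof -
  have growth: "\<theta> * x - Lambda_indep f \<theta> \<le> \<bar>ln r\<bar> - \<delta> / 4 * \<bar>\<theta>\<bar>" for \<theta>
  proof -
    have "x + sgn \<theta> * (\<delta> / 2) \<in> ball x \<delta>"
      using \<delta> by (simp add: dist_real_def abs_mult abs_sgn_eq)
    then obtain u where u: "f u = x + sgn \<theta> * (\<delta> / 2)"
      using ball by (metis imageE subsetD)
    have "\<theta> * f u = \<theta> * x + \<bar>\<theta>\<bar> * (\<delta> / 2)"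
      unfolding u distrib_left by (simp add: sgn_mult_self_eq abs_sgn[of \<theta>] mult.assoc)
    moreover have "\<bar>\<theta>\<bar> * (C * r) \<le> \<bar>\<theta>\<bar> * (\<delta> / 4)"
      using r(3) by (rule mult_left_mono) simp
    ultimately show ?thesis
      using Lambda_indep_ge[OF r(1,2), of \<theta> u] abs_ge_minus_self[of "ln r"] by (simp add: algebra_simps)
  qed
  have cases: "\<theta> * x - Lambda_indep f \<theta> \<le> 0 \<and> \<theta> * x - \<Lambda> \<theta> \<le> 0 \<or> \<bar>\<Lambda> \<theta> - Lambda_indep f \<theta>\<bar> \<le> \<epsilon>" for \<theta>
  proof (cases "\<bar>\<theta>\<bar> \<le> 8 * \<bar>ln r\<bar> / \<delta>")
    case True
    hence "\<bar>\<theta>\<bar> * d \<le> (8 * \<bar>ln r\<bar> / \<delta>) * d"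
      using d(1) by (rule mult_right_mono)
    thus ?thesis
      using near[of \<theta>] \<epsilon> by (simp add: mult.commute)
  next
    case False
    define P where "P = \<delta> / 8 * \<bar>\<theta>\<bar>"
    have "\<bar>ln r\<bar> < P"
      using False \<delta> by (simp add: P_def field_simps)
    moreover have "\<bar>\<theta>\<bar> * d \<le> P"
      using mult_left_mono[OF d(2), of "\<bar>\<theta>\<bar>"] by (simp add: P_def mult.commute)
    moreover have "0 \<le> P"
      using \<delta> by (simp add: P_def)
    moreover have "\<theta> * x - Lambda_indep f \<theta> \<le> \<bar>ln r\<bar> - 2 * P"
      using growth[of \<theta>] by (simp add: P_def)
    ultimately have "\<theta> * x - Lambda_indep f \<theta> \<le> 0" "\<theta> * x - \<Lambda> \<theta> \<le> 0"
      using near[of \<theta>] by linarith+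
    thus ?thesis
      by blast
  qed
  have zero: "Lambda_indep f 0 = 0" "\<Lambda> 0 = 0"
    using near[of 0] by (simp_all add: Lambda_indep_eq)
  have "legendre_fenchel \<Lambda> x \<le> legendre_fenchel (Lambda_indep f) x + ereal \<epsilon>"
  proof (rule legendre_fenchel_le_add)
    show "\<theta> * x - \<Lambda> \<theta> \<le> 0 \<or> Lambda_indep f \<theta> \<le> \<Lambda> \<theta> + \<epsilon>" for \<theta>
      using cases[of \<theta>] by (auto simp: abs_le_iff)
  qed (use zero \<epsilon> in auto)
  moreover have "legendre_fenchel (Lambda_indep f) x \<le> legendre_fenchel \<Lambda> x + ereal \<epsilon>"
  proof (rule legendre_fenchel_le_add)
    show "\<theta> * x - Lambda_indep f \<theta> \<le> 0 \<or> \<Lambda> \<theta> \<le> Lambda_indep f \<theta> + \<epsilon>" for \<theta>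
      using cases[of \<theta>] by (auto simp: abs_le_iff)
  qed (use zero \<epsilon> in auto)
  ultimately show ?thesis
    by (simp add: I_indep_def)
qed

text \<open>All values of \<open>f\<close> lie on one side of \<open>x\<close> at distance at least \<open>\<delta>\<close>, so that \<open>\<theta> x\<close> beats \<open>\<Lambda> \<theta>\<close> linearly
  as \<open>\<theta>\<close> tends to infinity with the right sign.\<close>

lemma rate_function_infinite_outside:
  assumes \<delta>: "0 < \<delta>" and ball: "ball x \<delta> \<inter> range f = {}"
    and near: "\<And>\<theta>. \<bar>\<Lambda> \<theta> - Lambda_indep f \<theta>\<bar> \<le> \<bar>\<theta>\<bar> * d" and d: "d \<le> \<delta> / 8"
  shows "legendre_fenchel \<Lambda> x = \<infinity>"
proof -
  have dist: "\<delta> \<le> \<bar>f u - x\<bar>" for u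
  proof -
    have "f u \<notin> ball x \<delta>"
      using ball by blast
    thus ?thesis
      by (simp add: dist_real_def abs_minus_commute)
  qed
  have conn: "connected (range f)"
    by (intro connected_continuous_image continuous_f connected_UNIV)
  have "x \<notin> range f"
    using ball \<delta> by (metis IntI centre_in_ball empty_iff)
  hence side: "(\<forall>u. f u \<le> x - \<delta>) \<or> (\<forall>u. x + \<delta> \<le> f u)"
    using dist connectedD_interval[OF conn] \<delta> by (smt (verit) rangeI)
  obtain s :: real where s: "\<bar>s\<bar> = 1" "\<And>u. s * f u \<le> s * x - \<delta>"
  proof (cases "\<forall>u. f u \<le> x - \<delta>")
    case True
    thus ?thesis
      by (intro that[of 1]) auto
  next
    case False
    hence "\<forall>u. x + \<delta> \<le> f u"
      using side by blast
    thus ?thesis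
      by (intro that[of "- 1"]) (auto simp: algebra_simps)
  qed
  show ?thesis
  proof (rule legendre_fenchel_eq_infinity[of "\<delta> / 2" s])
    fix t :: real
    assume t: "0 \<le> t"
    have "s * t * f u \<le> s * t * x - \<delta> * t" for u
      using mult_left_mono[OF s(2)[of u] t] by (simp add: algebra_simps)
    hence "Lambda_indep f (s * t) \<le> s * t * x - \<delta> * t"
      by (rule Lambda_indep_le)
    moreover have "\<bar>s * t\<bar> * d \<le> \<delta> * t / 8"
      using s(1) t mult_left_mono[OF d t] by (simp add: abs_mult mult.commute)
    moreover have "0 \<le> \<delta> * t"
      using t \<delta> by simp
    ultimately have "\<delta> * t / 2 \<le> s * t * x - \<Lambda> (s * t)"
      using near[of "s * t"] by linarith
    thus "\<delta> / 2 * t \<le> s * t * x - \<Lambda> (s * t)"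
      by simp
  qed (use \<delta> in simp)
qed

text \<open>A compact set \<open>K\<close> disjoint from the frontier of the range keeps a distance \<open>\<delta>\<close> from it, and a ball of
  radius \<open>\<delta>\<close> around a point of \<open>K\<close>, being connected, lies either inside the range or outside it.\<close>

lemma rate_functions_uniform_limit:
  assumes near: "\<And>q \<theta>. 2 \<le> q \<Longrightarrow> \<bar>\<Lambda> q \<theta> - Lambda_indep f \<theta>\<bar> \<le> 2 * (\<bar>\<theta>\<bar> * C) / real q"
    and K: "compact K" "K \<inter> frontier (range f) = {}"
  shows "ereal_uniform_limit K (\<lambda>q. legendre_fenchel (\<Lambda> q)) (I_indep f)"
  unfolding ereal_uniform_limit_def
proof (intro allI impI)
  fix \<epsilon> :: real
  assume \<epsilon>: "0 < \<epsilon>"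
  obtain \<delta> where \<delta>: "0 < \<delta>" "\<And>x y. x \<in> K \<Longrightarrow> y \<in> frontier (range f) \<Longrightarrow> \<delta> \<le> dist x y"
    using separate_compact_closed[OF K(1) frontier_closed K(2)] by blast
  define r where "r = min (1 / 2) (\<delta> / (4 * (C + 1)))"
  have r: "0 < r" "r \<le> 1 / 2" "C * r \<le> \<delta> / 4"
  proof -
    show "0 < r"
      using \<delta> C_nonneg by (simp add: r_def)
    have "C * r \<le> (C + 1) * (\<delta> / (4 * (C + 1)))"
      using C_nonneg \<open>0 < r\<close> by (intro mult_mono) (auto simp: r_def)
    also have "\<dots> = \<delta> / 4"
    proof -
      have cancel: "c * (\<delta> / (4 * c)) = \<delta> / 4" if "c \<noteq> 0" for c
        using that by simp
      show ?thesis
        by (rule cancel) (use C_nonneg in auto)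
    qed
    finally show "C * r \<le> \<delta> / 4" .
    show "r \<le> 1 / 2"
      unfolding r_def by (rule min.cobounded1)
  qed
  have lim0: "(\<lambda>q. 2 * C / real q) \<longlonglongrightarrow> 0" "(\<lambda>q. 2 * C / real q * (8 * \<bar>ln r\<bar> / \<delta>)) \<longlonglongrightarrow> 0"
    by real_asymp+
  have "\<forall>\<^sub>F q in sequentially. 2 * C / real q < \<delta> / 8"
    using \<delta>(1) by (intro order_tendstoD(2)[OF lim0(1)]) simp
  moreover have "\<forall>\<^sub>F q in sequentially. 2 * C / real q * (8 * \<bar>ln r\<bar> / \<delta>) < \<epsilon>"
    by (rule order_tendstoD(2)[OF lim0(2) \<epsilon>])
  ultimately show "\<forall>\<^sub>F q in sequentially. \<forall>x\<in>K. legendre_fenchel (\<Lambda> q) x \<le> I_indep f x + ereal \<epsilon>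
      \<and> I_indep f x \<le> legendre_fenchel (\<Lambda> q) x + ereal \<epsilon>"
    using eventually_ge_at_top[of 2]
  proof eventually_elim
    case (elim q)
    define d where "d = 2 * C / real q"
    have d: "0 \<le> d" "d \<le> \<delta> / 8" "d * (8 * \<bar>ln r\<bar> / \<delta>) \<le> \<epsilon>"
      using elim C_nonneg by (simp_all add: d_def)
    have nearq: "\<bar>\<Lambda> q \<theta> - Lambda_indep f \<theta>\<bar> \<le> \<bar>\<theta>\<bar> * d" for \<theta>
      using near[OF elim(3), of \<theta>] by (simp add: d_def ac_simps)
    show ?case
    proof
      fix x
      assume x: "x \<in> K"
      have "ball x \<delta> \<inter> frontier (range f) = {}"
        using \<delta>(2)[OF x] by force
      hence "ball x \<delta> \<inter> range f = {} \<or> ball x \<delta> \<subseteq> range f"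
        using connected_Int_frontier[of "ball x \<delta>" "range f"] by auto
      thus "legendre_fenchel (\<Lambda> q) x \<le> I_indep f x + ereal \<epsilon>
          \<and> I_indep f x \<le> legendre_fenchel (\<Lambda> q) x + ereal \<epsilon>"
      proof
        assume "ball x \<delta> \<subseteq> range f"
        thus ?thesis
          using \<delta>(1) \<epsilon> r nearq d by (intro rate_function_close_inside) auto
      next
        assume out: "ball x \<delta> \<inter> range f = {}"
        have "legendre_fenchel (\<Lambda> q) x = \<infinity>"
          by (rule rate_function_infinite_outside[OF \<delta>(1) out nearq d(2)])
        moreover have "legendre_fenchel (Lambda_indep f) x = \<infinity>"
          by (rule rate_function_infinite_outside[OF \<delta>(1) out, of _ 0]) (use \<delta>(1) in auto)
        ultimately show ?thesis
          by (simp add: I_indep_def)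
      qed
    qed
  qed
qed

end

section \<open>The large deviation principle for geometric lacunary sums\<close>

lemma expectation_uniform:
  fixes F :: "real \<Rightarrow> 'b::euclidean_space"
  assumes U: "U \<in> borel_measurable M" "distr M lborel U = uniform_measure lborel {0..1}"
    and F: "continuous_on UNIV F"
  shows "(\<integral>\<omega>. F (U \<omega>) \<partial>M) = integral {0..1} F"
proof -
  have [measurable]: "F \<in> borel_measurable borel"
    using F by (rule borel_measurable_continuous_onI)
  have "(\<integral>\<omega>. F (U \<omega>) \<partial>M) = (\<integral>x. F x \<partial>distr M lborel U)"
    using U(1) by (subst integral_distr) auto
  also have "uniform_measure lborel {0..1::real} = density lborel (\<lambda>x. ennreal (indicator {0..1} x))"
    unfolding uniform_measure_def by (intro density_cong) (auto simp: indicator_def)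
  hence "(\<integral>x. F x \<partial>distr M lborel U) = (LINT x:{0..1}|lborel. F x)"
    unfolding U(2) set_lebesgue_integral_def by (simp add: integral_density)
  also have "\<dots> = integral {0..1} F"
    by (intro set_borel_integral_eq_integral borel_integrable_atLeastAtMost' continuous_on_subset[OF F]) auto
  finally show ?thesis .
qed

theorem theorem2:
  fixes M :: "'a measure" and U :: "'a \<Rightarrow> real" and f :: "real \<Rightarrow> real"
  assumes "prob_space M"
    and "U \<in> borel_measurable M"
    and "distr M lborel U = uniform_measure lborel {0..1}"
    and "\<And>x. f (x + 1) = f x"
    and "\<exists>C. C-lipschitz_on UNIV f"
  shows "(\<forall>q::nat. 2 \<le> q \<longrightarrow>
            (\<forall>\<theta>::real. (\<lambda>n. scaled_log_mgf M U f q n \<theta>) \<longlonglongrightarrow> Lambda_geom M U f q \<theta>) \<and>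
            (\<exists>D::complex set. open D \<and> range complex_of_real \<subseteq> D \<and>
               complex_log_mgf_converges M (geometric_sum q f U) (Lambda_geom M U f q) D) \<and>
            satisfies_LDP M (\<lambda>n \<omega>. geometric_sum q f U n \<omega> / real n) (\<lambda>n. real n)
              (I_geom M U f q) \<and>
            good_rate_function (I_geom M U f q))
       \<and> (\<forall>K. compact K \<and> K \<subseteq> {-1<..<1} - frontier (range f) \<longrightarrow>
            ereal_uniform_limit K (I_geom M U f) (I_indep f))"
proof -
  obtain C where "C-lipschitz_on UNIV f"
    using assms(5) by blast
  then interpret lipschitz_periodic f C
    using assms(4) by unfold_locales
  have [measurable]: "f \<in> borel_measurable borel" "U \<in> borel_measurable M"
    by (intro borel_measurable_continuous_onI continuous_f) (rule assms(2))
  have expectation_exp: "(\<integral>\<omega>. exp (z * of_real (geometric_sum q f U n \<omega>)) \<partial>M) = geometric_mgf q f n z"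
    for z :: "'b::{real_normed_field,banach,euclidean_space}" and q n
  proof -
    have "continuous_on UNIV (\<lambda>x. exp (z * of_real (\<Sum>k=1..n. f (real (q ^ k) * x))))"
      by (intro continuous_intros continuous_on_compose2[OF continuous_f[of UNIV]]) auto
    from expectation_uniform[OF assms(2,3) this] show ?thesis
      by (simp only: geometric_mgf_def lacunary_sum_def)
  qed
  have mgf_eq: "(\<integral>\<omega>. exp (\<theta> * geometric_sum q f U n \<omega>) \<partial>M) = geometric_mgf q f n \<theta>"
    for \<theta> :: real and q n
    using expectation_exp[of \<theta> q n] by simp
  have limit: "(\<lambda>n. ln (geometric_mgf q f n \<theta>) / real n) \<longlonglongrightarrow> Lambda_geom M U f q \<theta>"
    and near: "\<bar>Lambda_geom M U f q \<theta> - Lambda_indep f \<theta>\<bar> \<le> 2 * (\<bar>\<theta>\<bar> * C) / real q"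
    if q: "2 \<le> q" for q \<theta>
  proof -
    obtain l where l: "(\<lambda>n. ln (geometric_mgf q f n \<theta>) / real n) \<longlonglongrightarrow> l"
      "\<bar>l - Lambda_indep f \<theta>\<bar> \<le> 2 * (\<bar>\<theta>\<bar> * C) / real q"
      by (rule log_mgf_limit[OF q])
    have "Lambda_geom M U f q \<theta> = l"
      unfolding Lambda_geom_def scaled_log_mgf_def mgf_eq by (rule limI[OF l(1)])
    with l show "(\<lambda>n. ln (geometric_mgf q f n \<theta>) / real n) \<longlonglongrightarrow> Lambda_geom M U f q \<theta>"
      "\<bar>Lambda_geom M U f q \<theta> - Lambda_indep f \<theta>\<bar> \<le> 2 * (\<bar>\<theta>\<bar> * C) / real q"
      by simp_all
  qed
  obtain B where B: "0 < B" "\<And>x. \<bar>f x\<bar> \<le> B"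
    using bounded_f by blast
  show ?thesis
  proof (intro conjI allI impI)
    fix q :: nat
    assume q: "2 \<le> q"
    show "(\<lambda>n. scaled_log_mgf M U f q n \<theta>) \<longlonglongrightarrow> Lambda_geom M U f q \<theta>" for \<theta>
      unfolding scaled_log_mgf_def mgf_eq by (rule limit[OF q])
    show "\<exists>D::complex set. open D \<and> range complex_of_real \<subseteq> D \<and>
        complex_log_mgf_converges M (geometric_sum q f U) (Lambda_geom M U f q) D"
    proof -
      obtain D L g where D: "open D" "range complex_of_real \<subseteq> D"
        and L: "\<And>n. L n holomorphic_on D"
          "\<And>n z. z \<in> D \<Longrightarrow> exp (L n z) = geometric_mgf q f n z"
          "\<And>n \<theta>. L n (complex_of_real \<theta>) = complex_of_real (ln (geometric_mgf q f n \<theta>))"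
        and g: "\<And>\<theta>. g (complex_of_real \<theta>) = complex_of_real (Lambda_geom M U f q \<theta>)"
          "\<And>K. compact K \<Longrightarrow> K \<subseteq> D \<Longrightarrow> uniform_limit K (\<lambda>n z. L n z / of_nat n) g sequentially"
        by (rule complex_log_mgf[of q "Lambda_geom M U f q", OF q limit[OF q]]) blast
      have "complex_log_mgf_converges M (geometric_sum q f U) (Lambda_geom M U f q) D"
        unfolding complex_log_mgf_converges_def expectation_exp mgf_eq
        by (intro exI[of _ L] exI[of _ g]) (use L g in auto)
      with D show ?thesis
        by blast
    qed
    interpret mgf_limit M "geometric_sum q f U" B "Lambda_geom M U f q"
    proof (intro mgf_limit.intro mgf_limit_axioms.intro assms(1))
      show "geometric_sum q f U n \<in> borel_measurable M" for n
        unfolding lacunary_sum_def by measurable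
      show "\<bar>geometric_sum q f U n \<omega>\<bar> \<le> B * real n" for n \<omega>
      proof -
        have "\<bar>geometric_sum q f U n \<omega>\<bar> \<le> (\<Sum>k=1..n. \<bar>f (real (q ^ k) * U \<omega>)\<bar>)"
          unfolding lacunary_sum_def by (rule sum_abs)
        also have "\<dots> \<le> (\<Sum>k=1..n. B)"
          by (intro sum_mono B)
        finally show ?thesis
          by (simp add: mult.commute)
      qed
      show "(\<lambda>n. ln (\<integral>\<omega>. exp (\<theta> * geometric_sum q f U n \<omega>) \<partial>M) / real n) \<longlonglongrightarrow> Lambda_geom M U f q \<theta>" for \<theta>
        unfolding mgf_eq by (rule limit[OF q])
    qed
    show "satisfies_LDP M (\<lambda>n \<omega>. geometric_sum q f U n \<omega> / real n) (\<lambda>n. real n) (I_geom M U f q)"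
      unfolding I_geom_def
      by (rule gaertner_ellis) (rule differentiable_log_mgf_limit[OF q limit[OF q]])
    show "good_rate_function (I_geom M U f q)"
      unfolding I_geom_def by (rule good_rate_function_legendre_fenchel)
  next
    fix K :: "real set"
    assume K: "compact K \<and> K \<subseteq> {-1<..<1} - frontier (range f)"
    hence "ereal_uniform_limit K (\<lambda>q. legendre_fenchel (Lambda_geom M U f q)) (I_indep f)"
      by (intro rate_functions_uniform_limit near) auto
    thus "ereal_uniform_limit K (I_geom M U f) (I_indep f)"
      by (simp add: I_geom_def[abs_def])
  qed
qed

end
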